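(* Let $\mathfrak g$ be an affine Lie algebra of type $X_N^{(1)}$, let $V$ be its Verlinde algebra at level $k$ ($k$ a positive integer), and set $\mathcal A=\mathring P/\mathring Q$. The algebra $V$ has an $\mathcal A$-grading $$V=\bigoplus_{a\in\mathcal A}V_a,\qquad V_a=\mathrm{span}\{\chi_\lambda:\lambda\in P_k^+\text{ and }\overline\lambda\in a\}.$$
   Context: $\mathfrak g$ is the untwisted affine Kac–Moody algebra with underlying finite dimensional simple Lie algebra $\mathring{\mathfrak g}$ of rank $\ell$. $\mathring P$ and $\mathring Q$ are the weight lattice and root lattice of $\mathring{\mathfrak g}$, $\mathring W$ its Weyl group with sign character $\epsilon$, $\mathring\Delta_+$ its positive roots, $\overline\rho$ the half-sum of positive roots, $\theta$ its highest root, and $(\cdot,\cdot)$ the invariant form normalized by $(\theta,\theta)=2$. $h^\vee$ is the dual Coxeter number; $M=\nu(\mathring Q^\vee)\subset\mathring{\mathfrak h}^*$ is the coroot lattice transported to $\mathring{\mathfrak h}^*$ by the form, and $M^*=\mathring P$ its dual lattice. $P_k^+$ is the set of dominant integral weights of $\mathfrak g$ of level $k$; modulo $\mathbb C\delta$ such a $\lambda$ is determined by its finite part $\overline\lambda$, which ranges over the dominant $\overline\lambda\in\mathring P$ with $(\overline\lambda,\theta)\le k$. $\Lambda_0$ is the zeroth fundamental weight ($\overline\Lambda_0=0$). $\chi_\lambda$ is the normalized character of the irreducible integrable highest weight $\mathfrak g$-module $L_\lambda$. The Verlinde algebra at level $k$ is the complex vector space with basis $\chi_\lambda$, $\lambda\in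 P_k^+$ mod $\mathbb C\delta$, and product $\chi_\lambda\chi_\mu=\sum_\nu N_{\lambda\mu}^\nu\chi_\nu$, where $$N_{\lambda\mu}^\nu=\sum_{\phi\in P_k^+\bmod\mathbb C\delta}\frac{S_{\lambda\phi}S_{\mu\phi}(S^{-1})_{\nu\phi}}{S_{k\Lambda_0,\phi}},$$ $$S_{\lambda\mu}=i^{|\mathring\Delta_+|}\,|M^*/(k+h^\vee)M|^{-1/2}\sum_{w\in\mathring W}\epsilon(w)e^{-\frac{2\pi i(\overline\lambda+\overline\rho,\,w(\overline\mu+\overline\rho))}{k+h^\vee}}.$$ An $\mathcal A$-grading means $V_aV_b\subseteq V_{a+b}$ for all $a,b\in\mathcal A$. *)

theory Defs
  imports
    "HOL-Analysis.Analysis"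
    "HOL-Library.Function_Algebras"
    "HOL-Computational_Algebra.Group_Closure"
    "HOL-Algebra.Coset"
begin

section \<open>Root data of a finite dimensional simple Lie algebra\<close>

text \<open>
  A finite dimensional simple Lie algebra of rank \<open>\<ell>\<close> (equivalently, the untwisted affine algebra
  built on it) enters through its root system \<open>R\<close>, an arbitrary irreducible reduced
  crystallographic root system, together with a choice \<open>B\<close> of simple roots.  The ambient space
  \<open>real ^ 'l\<close> is the real form of the dual of the Cartan subalgebra, so \<open>CARD('l) = \<ell>\<close>; its
  standard inner product \<open>\<bullet>\<close> is some Weyl group invariant inner product, not necessarily the
  normalized one.
\<close>

definition reflection :: "real ^ 'l \<Rightarrow> real ^ 'l \<Rightarrow> real ^ 'l" where
  "reflection \<alpha> x = x - (2 * (x \<bullet> \<alpha>) / (\<alpha> \<bullet> \<alpha>)) *\<^sub>R \<alpha>"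

definition root_system :: "(real ^ 'l) set \<Rightarrow> bool" where
  "root_system R \<longleftrightarrow>
     finite R \<and> 0 \<notin> R \<and> span R = UNIV \<and>
     (\<forall>\<alpha>\<in>R. \<forall>\<beta>\<in>R. reflection \<alpha> \<beta> \<in> R) \<and>
     (\<forall>\<alpha>\<in>R. \<forall>\<beta>\<in>R. 2 * (\<beta> \<bullet> \<alpha>) / (\<alpha> \<bullet> \<alpha>) \<in> \<int>) \<and>
     (\<forall>\<alpha>\<in>R. \<forall>c. c *\<^sub>R \<alpha> \<in> R \<longrightarrow> c = 1 \<or> c = -1)"

definition irreducible_root_system :: "(real ^ 'l) set \<Rightarrow> bool" where
  "irreducible_root_system R \<longleftrightarrow>
     root_system R \<and>
     \<not> (\<exists>R1 R2. R1 \<noteq> {} \<and> R2 \<noteq> {} \<and> R1 \<union> R2 = R \<and> (\<forall>\<alpha>\<in>R1. \<forall>\<beta>\<in>R2. \<alpha> \<bullet> \<beta> = 0))"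

definition nonneg_comb :: "(real ^ 'l) set \<Rightarrow> real ^ 'l \<Rightarrow> bool" where
  "nonneg_comb B x \<longleftrightarrow> (\<exists>c :: real ^ 'l \<Rightarrow> nat. x = (\<Sum>\<alpha>\<in>B. real (c \<alpha>) *\<^sub>R \<alpha>))"

definition simple_roots :: "(real ^ 'l) set \<Rightarrow> (real ^ 'l) set \<Rightarrow> bool" where
  "simple_roots R B \<longleftrightarrow>
     B \<subseteq> R \<and> independent B \<and> (\<forall>\<beta>\<in>R. nonneg_comb B \<beta> \<or> nonneg_comb B (- \<beta>))"

definition pos_roots :: "(real ^ 'l) set \<Rightarrow> (real ^ 'l) set \<Rightarrow> (real ^ 'l) set" where
  "pos_roots R B = {\<alpha> \<in> R. nonneg_comb B \<alpha>}"

definition weyl_vector :: "(real ^ 'l) set \<Rightarrow> (real ^ 'l) set \<Rightarrow> real ^ 'l" where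
  "weyl_vector R B = (1 / 2) *\<^sub>R (\<Sum>\<alpha>\<in>pos_roots R B. \<alpha>)"

definition highest_root :: "(real ^ 'l) set \<Rightarrow> (real ^ 'l) set \<Rightarrow> real ^ 'l" where
  "highest_root R B = (THE \<theta>. \<theta> \<in> R \<and> (\<forall>\<alpha>\<in>R. nonneg_comb B (\<theta> - \<alpha>)))"

definition nform :: "(real ^ 'l) set \<Rightarrow> (real ^ 'l) set \<Rightarrow> real ^ 'l \<Rightarrow> real ^ 'l \<Rightarrow> real" where
  "nform R B x y = 2 * (x \<bullet> y) / (highest_root R B \<bullet> highest_root R B)"

inductive_set weyl_group :: "(real ^ 'l) set \<Rightarrow> (real ^ 'l \<Rightarrow> real ^ 'l) set"
  for R :: "(real ^ 'l) set" where
  id: "(\<lambda>x. x) \<in> weyl_group R"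
| refl: "w \<in> weyl_group R \<Longrightarrow> \<alpha> \<in> R \<Longrightarrow> reflection \<alpha> \<circ> w \<in> weyl_group R"

definition weyl_sign :: "(real ^ 'l \<Rightarrow> real ^ 'l) \<Rightarrow> real" where
  "weyl_sign w = det (matrix w)"

text \<open>The coroot \<open>\<alpha>\<^sup>\<or>\<close> transported by \<open>\<nu>\<close>, the isomorphism given by the normalized form.\<close>

definition nu_coroot :: "(real ^ 'l) set \<Rightarrow> (real ^ 'l) set \<Rightarrow> real ^ 'l \<Rightarrow> real ^ 'l" where
  "nu_coroot R B \<alpha> = (2 / nform R B \<alpha> \<alpha>) *\<^sub>R \<alpha>"

text \<open>One plus the sum of the coefficients of \<open>\<theta>\<^sup>\<or>\<close> with respect to the simple coroots; these
  coefficients and \<open>1\<close> are the dual labels of the affine Dynkin diagram.\<close>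

definition dual_coxeter :: "(real ^ 'l) set \<Rightarrow> (real ^ 'l) set \<Rightarrow> real" where
  "dual_coxeter R B =
     1 + (\<Sum>b \<in> nu_coroot R B ` B.
            representation (nu_coroot R B ` B) (nu_coroot R B (highest_root R B)) b)"


section \<open>Lattices\<close>

definition root_lattice :: "(real ^ 'l) set \<Rightarrow> (real ^ 'l) set" where
  "root_lattice R = group_closure R"

definition coroot_lattice :: "(real ^ 'l) set \<Rightarrow> (real ^ 'l) set \<Rightarrow> (real ^ 'l) set" where
  "coroot_lattice R B = group_closure (nu_coroot R B ` R)"

definition weight_lattice :: "(real ^ 'l) set \<Rightarrow> (real ^ 'l) set \<Rightarrow> (real ^ 'l) set" where
  "weight_lattice R B = {x. \<forall>\<alpha>\<in>R. nform R B x (nu_coroot R B \<alpha>) \<in> \<int>}"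

definition dual_lattice ::
  "(real ^ 'l) set \<Rightarrow> (real ^ 'l) set \<Rightarrow> (real ^ 'l) set \<Rightarrow> (real ^ 'l) set" where
  "dual_lattice R B L = {x. \<forall>y\<in>L. nform R B x y \<in> \<int>}"

definition add_group :: "'a :: ab_group_add set \<Rightarrow> 'a monoid" where
  "add_group L = \<lparr>carrier = L, mult = (+), one = 0\<rparr>"

definition grading_group :: "(real ^ 'l) set \<Rightarrow> (real ^ 'l) set \<Rightarrow> (real ^ 'l) set monoid" where
  "grading_group R B = add_group (weight_lattice R B) Mod root_lattice R"


section \<open>The Verlinde algebra\<close>

text \<open>A dominant integral weight of level \<open>k\<close>, taken modulo \<open>\<complex>\<delta>\<close>, is represented by its finite
  part; in particular \<open>k\<Lambda>\<^sub>0\<close> is represented by \<open>0\<close>.\<close>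

definition level_weights :: "(real ^ 'l) set \<Rightarrow> (real ^ 'l) set \<Rightarrow> nat \<Rightarrow> (real ^ 'l) set" where
  "level_weights R B k =
     {x \<in> weight_lattice R B.
        (\<forall>\<alpha>\<in>B. 0 \<le> nform R B x (nu_coroot R B \<alpha>)) \<and> nform R B x (highest_root R B) \<le> real k}"

definition S_matrix ::
  "(real ^ 'l) set \<Rightarrow> (real ^ 'l) set \<Rightarrow> nat \<Rightarrow> real ^ 'l \<Rightarrow> real ^ 'l \<Rightarrow> complex" where
  "S_matrix R B k x y =
     (let \<rho> = weyl_vector R B; \<kappa> = real k + dual_coxeter R B; M = coroot_lattice R B in
        \<i> ^ card (pos_roots R B) *
        of_real (real (order (add_group (dual_lattice R B M) Mod ((*\<^sub>R) \<kappa> ` M))) powr (- 1 / 2)) *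
        (\<Sum>w\<in>weyl_group R.
           of_real (weyl_sign w) *
           exp (- (2 * of_real pi * \<i> * of_real (nform R B (x + \<rho>) (w (y + \<rho>)))) / of_real \<kappa>)))"

text \<open>The two-sided inverse of a matrix indexed by \<open>I\<close>.\<close>

definition matrix_inverse_on :: "'i set \<Rightarrow> ('i \<Rightarrow> 'i \<Rightarrow> complex) \<Rightarrow> 'i \<Rightarrow> 'i \<Rightarrow> complex" where
  "matrix_inverse_on I A =
     (THE C. (\<forall>i j. i \<notin> I \<or> j \<notin> I \<longrightarrow> C i j = 0) \<and>
             (\<forall>i\<in>I. \<forall>j\<in>I. (\<Sum>m\<in>I. A i m * C m j) = (if i = j then 1 else 0)) \<and>
             (\<forall>i\<in>I. \<forall>j\<in>I. (\<Sum>m\<in>I. C i m * A m j) = (if i = j then 1 else 0)))"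

definition fusion_coeff ::
  "(real ^ 'l) set \<Rightarrow> (real ^ 'l) set \<Rightarrow> nat \<Rightarrow> real ^ 'l \<Rightarrow> real ^ 'l \<Rightarrow> real ^ 'l \<Rightarrow> complex" where
  "fusion_coeff R B k x y z =
     (\<Sum>\<phi>\<in>level_weights R B k.
        S_matrix R B k x \<phi> * S_matrix R B k y \<phi> *
        matrix_inverse_on (level_weights R B k) (S_matrix R B k) z \<phi> / S_matrix R B k 0 \<phi>)"

text \<open>An element of the Verlinde algebra is identified with its family of coefficients with respect
  to the basis \<open>\<chi>\<^sub>\<lambda>\<close>.\<close>

definition verlinde_space :: "(real ^ 'l) set \<Rightarrow> (real ^ 'l) set \<Rightarrow> nat \<Rightarrow> (real ^ 'l \<Rightarrow> complex) set"
  where "verlinde_space R B k = {f. \<forall>x. x \<notin> level_weights R B k \<longrightarrow> f x = 0}"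

definition chi :: "real ^ 'l \<Rightarrow> real ^ 'l \<Rightarrow> complex" where
  "chi x = (\<lambda>y. if y = x then 1 else 0)"

definition verlinde_mult ::
  "(real ^ 'l) set \<Rightarrow> (real ^ 'l) set \<Rightarrow> nat \<Rightarrow>
   (real ^ 'l \<Rightarrow> complex) \<Rightarrow> (real ^ 'l \<Rightarrow> complex) \<Rightarrow> (real ^ 'l \<Rightarrow> complex)" where
  "verlinde_mult R B k f g =
     (\<lambda>z. if z \<in> level_weights R B k
          then \<Sum>x\<in>level_weights R B k. \<Sum>y\<in>level_weights R B k. f x * g y * fusion_coeff R B k x y z
          else 0)"

definition cscale :: "complex \<Rightarrow> ('i \<Rightarrow> complex) \<Rightarrow> ('i \<Rightarrow> complex)" where
  "cscale c f = (\<lambda>i. c * f i)"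

global_interpretation cfun: vector_space "cscale :: complex \<Rightarrow> ('i \<Rightarrow> complex) \<Rightarrow> ('i \<Rightarrow> complex)"
  by unfold_locales (auto simp: cscale_def fun_eq_iff algebra_simps)

definition verlinde_component ::
  "(real ^ 'l) set \<Rightarrow> (real ^ 'l) set \<Rightarrow> nat \<Rightarrow> (real ^ 'l) set \<Rightarrow> (real ^ 'l \<Rightarrow> complex) set" where
  "verlinde_component R B k a = cfun.span (chi ` {x \<in> level_weights R B k. x \<in> a})"


section \<open>Gradings\<close>

definition direct_sum_decomposition ::
  "'j set \<Rightarrow> ('i \<Rightarrow> complex) set \<Rightarrow> ('j \<Rightarrow> ('i \<Rightarrow> complex) set) \<Rightarrow> bool" where
  "direct_sum_decomposition J V W \<longleftrightarrow>
     (\<forall>a\<in>J. cfun.subspace (W a) \<and> W a \<subseteq> V) \<and>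
     (\<forall>v\<in>V. \<exists>!f. (\<forall>a\<in>J. f a \<in> W a) \<and> (\<forall>a. a \<notin> J \<longrightarrow> f a = 0) \<and>
                finite {a. f a \<noteq> 0} \<and> v = (\<Sum>a | f a \<noteq> 0. f a))"

definition algebra_grading ::
  "('j, 'm) monoid_scheme \<Rightarrow> ('i \<Rightarrow> complex) set \<Rightarrow>
   (('i \<Rightarrow> complex) \<Rightarrow> ('i \<Rightarrow> complex) \<Rightarrow> ('i \<Rightarrow> complex)) \<Rightarrow>
   ('j \<Rightarrow> ('i \<Rightarrow> complex) set) \<Rightarrow> bool" where
  "algebra_grading G V mul W \<longleftrightarrow>
     comm_group G \<and> direct_sum_decomposition (carrier G) V W \<and>
     (\<forall>a\<in>carrier G. \<forall>b\<in>carrier G. \<forall>x\<in>W a. \<forall>y\<in>W b. mul x y \<in> W (a \<otimes>\<^bsub>G\<^esub> b))"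

end

theory Submission
  imports Defs
begin

text \<open>
  Write \<open>\<kappa> = k + h\<close> with \<open>h\<close> the dual Coxeter number, \<open>P\<close> and \<open>Q\<close> for the weight and root lattice.
  Up to a constant, the S-matrix entry at \<open>(x, y)\<close> is \<open>F (x + \<rho>) (y + \<rho>)\<close>, where \<open>F u v\<close> is an
  alternating sum of exponentials over the Weyl group: as a function of \<open>v \<in> P\<close> it is
  antisymmetric, \<open>\<kappa> M\<close>-periodic, and zero on the walls of the affine Weyl group.  The set
  \<open>level_weights + \<rho>\<close> is the set of points of \<open>P\<close> in the open fundamental alcove, on whose
  translates the affine Weyl group acts simply transitively, so a sum of an invariant function over
  it is, up to the order of the Weyl group, a sum over \<open>P / \<kappa> M\<close>.  Orthogonality of characters of
  that finite group then makes the S-matrix unitary up to a scalar, and writes the fusion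
  coefficient of \<open>(x, y, z)\<close> as a sum over \<open>P / \<kappa> M\<close> of a function which a shift by \<open>\<kappa> m\<close>, with \<open>m\<close>
  in the lattice dual to \<open>Q\<close>, multiplies by \<open>exp (- 2 \<pi> i (x + y - z, m))\<close>.  If the coefficient is
  nonzero, all these factors are \<open>1\<close>, that is, \<open>x + y - z \<in> Q\<close>.
\<close>

section \<open>Root systems\<close>

text \<open>The class of a weight modulo \<open>Q\<close> is read off by pairing with
  \<open>Pv\<close>, but translation by \<open>\<kappa> m\<close> with \<open>m\<close> in
  \<open>Pv\<close> need not belong to the affine Weyl group, and it moves the alcove. Followed by a
  suitable affine Weyl element it would give a diagram automorphism permuting the level
  \<open>k\<close> weights; on \<open>P\<close> modulo \<open>\<kappa> M\<close> it is a plain shift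
  of a finite group, and the automorphism never has to be described. The price is that both halves
  of simple transitivity are required. Transitivity comes from a minimal distance; freeness comes
  from the exchange property for words, and for this every map
  \<open>x \<mapsto> w x + \<kappa> m\<close> must be a word in the simple affine reflections. The
  inverse matrix is the other obstacle: the shift law concerns alternating sums, so the inverse must
  be made explicit, and unitarity turns it into conjugates of such sums. Irreducibility enters
  through the highest root and the long roots: they give the integral length ratios behind
  \<open>Pv \<subseteq> P\<close> and carry the translation by \<open>\<kappa> \<theta>\<close> to
  all of \<open>\<kappa> M\<close>.\<close>

definition cartan :: "real ^ 'l \<Rightarrow> real ^ 'l \<Rightarrow> real" where
  "cartan x a = 2 * (x \<bullet> a) / (a \<bullet> a)"

lemma reflection_cartan: "reflection a x = x - cartan x a *\<^sub>R a"
  by (simp add: reflection_def cartan_def)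

lemma cartan_add: "cartan (x + y) a = cartan x a + cartan y a"
  by (simp add: cartan_def inner_add_left algebra_simps add_divide_distrib)

lemma cartan_diff: "cartan (x - y) a = cartan x a - cartan y a"
  by (simp add: cartan_def inner_diff_left algebra_simps diff_divide_distrib)

lemma cartan_scaleR: "cartan (c *\<^sub>R x) a = c * cartan x a"
  by (simp add: cartan_def)

lemma cartan_minus_right: "cartan x (- a) = - cartan x a"
  by (simp add: cartan_def)

lemma cartan_self: "a \<noteq> 0 \<Longrightarrow> cartan a a = 2"
  by (simp add: cartan_def)

lemma linear_reflection: "linear (reflection a)"
  by (rule linearI) (simp_all add: reflection_def inner_add_left algebra_simps add_divide_distrib)

lemma reflection_self: "a \<noteq> 0 \<Longrightarrow> reflection a a = - a"
  by (simp add: reflection_def scaleR_2)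

lemma reflection_swap: "reflection a x \<bullet> y = x \<bullet> reflection a y"
  by (simp add: reflection_def inner_diff_left inner_diff_right inner_commute)

lemma reflection_reflection [simp]: "reflection a (reflection a x) = x"
  by (cases "a = 0") (simp_all add: reflection_def inner_diff_left algebra_simps)

lemma inner_reflection [simp]: "reflection a x \<bullet> reflection a y = x \<bullet> y"
  by (simp add: reflection_swap)

lemma reflection_conj:
  assumes "linear g" "\<And>x y. g x \<bullet> g y = x \<bullet> y"
  shows "reflection (g a) (g x) = g (reflection a x)"
  by (simp add: reflection_def assms linear_diff linear_cmul)

lemma reflection_uminus [simp]: "reflection (- a) = reflection a"
  by (simp add: fun_eq_iff reflection_def)

text \<open>An isometry carries a coordinate axis to the line of \<open>a\<close>, and reflection in
  an axis vector is diagonal with a single entry -1. The vector \<open>e\<close> has the norm of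
  \<open>a\<close> so that such an isometry sends it to \<open>a\<close> exactly.\<close>

lemma det_reflection:
  fixes a :: "real ^ 'l"
  assumes "a \<noteq> 0"
  shows "det (matrix (reflection a)) = -1"
proof -
  fix i :: 'l
  define e :: "real ^ 'l" where "e = axis i (norm a)"
  have refl_e: "reflection e x $ j = (if j = i then - x $ j else x $ j)" for x j
    using assms by (simp add: reflection_def e_def inner_axis inner_axis_axis) (simp add: axis_def)
  have "norm e = norm a" by (simp add: e_def norm_eq_sqrt_inner inner_axis_axis)
  then obtain g where g: "orthogonal_transformation g" "g e = a"
    using orthogonal_transformation_exists[of e a] by metis
  have lin: "linear g" and inn: "\<And>x y. g x \<bullet> g y = x \<bullet> y"
    using g(1) by (auto simp: orthogonal_transformation_def)
  have "reflection a \<circ> g = g \<circ> reflection e"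
    using reflection_conj[OF lin inn, of e] g(2) by (simp add: fun_eq_iff)
  then have "matrix (reflection a) ** matrix g = matrix g ** matrix (reflection e)"
    by (metis matrix_compose linear_reflection lin)
  then have "det (matrix (reflection a)) * det (matrix g) = det (matrix g) * det (matrix (reflection e))"
    by (metis det_mul)
  moreover have "det (matrix g) \<noteq> 0"
    using g(1) orthogonal_transformation_matrix det_orthogonal_matrix by fastforce
  ultimately have "det (matrix (reflection a)) = det (matrix (reflection e))"
    by simp
  also have "\<dots> = (\<Prod>j\<in>UNIV. matrix (reflection e) $ j $ j)"
    by (rule det_diagonal) (simp add: matrix_def refl_e axis_def)
  also have "\<dots> = (\<Prod>j\<in>UNIV. if j = i then -1 else 1)"
    by (intro prod.cong) (auto simp: matrix_def refl_e axis_def)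
  also have "\<dots> = -1" by (simp add: prod.delta)
  finally show ?thesis .
qed

locale root_data =
  fixes R B :: "(real ^ 'l) set"
  assumes irred: "irreducible_root_system R" and simp_roots: "simple_roots R B"
begin

lemma finite_R: "finite R" and zero_notin_R: "0 \<notin> R" and span_R: "span R = UNIV"
  and reflection_in_R: "\<And>a b. a \<in> R \<Longrightarrow> b \<in> R \<Longrightarrow> reflection a b \<in> R"
  and cartan_Ints: "\<And>a b. a \<in> R \<Longrightarrow> b \<in> R \<Longrightarrow> cartan b a \<in> \<int>"
  and reduced: "\<And>a c. a \<in> R \<Longrightarrow> c *\<^sub>R a \<in> R \<Longrightarrow> c = 1 \<or> c = -1"
  using irred by (auto simp: irreducible_root_system_def root_system_def cartan_def)

lemma orthogonal_split_trivial:
  assumes "R1 \<union> R2 = R" "\<And>a b. a \<in> R1 \<Longrightarrow> b \<in> R2 \<Longrightarrow> a \<bullet> b = 0" "R1 \<noteq> {}"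
  shows "R2 = {}"
  using irred assms unfolding irreducible_root_system_def by blast

lemma B_subset: "B \<subseteq> R" and indep_B: "independent B"
  and pos_or_neg: "\<And>b. b \<in> R \<Longrightarrow> nonneg_comb B b \<or> nonneg_comb B (- b)"
  using simp_roots by (auto simp: simple_roots_def)

lemma finite_B: "finite B" using finite_subset B_subset finite_R by blast

lemma root_nonzero: "a \<in> R \<Longrightarrow> a \<noteq> 0" using zero_notin_R by auto

lemma root_uminus: "a \<in> R \<Longrightarrow> - a \<in> R"
  using reflection_in_R[of a a] by (simp add: reflection_self root_nonzero)

lemma nonneg_comb_in_span: "nonneg_comb B x \<Longrightarrow> x \<in> span B"
  unfolding nonneg_comb_def by (auto intro!: span_sum intro: span_scale span_base)

lemma span_B: "span B = UNIV"
proof -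
  have "R \<subseteq> span B"
    using pos_or_neg nonneg_comb_in_span span_neg by fastforce
  then have "span R \<subseteq> span B" by (rule span_minimal) simp
  with span_R show ?thesis by auto
qed

definition coef :: "real ^ 'l \<Rightarrow> real ^ 'l \<Rightarrow> real" where
  "coef x b = representation B x b"

lemma coef_add: "coef (x + y) b = coef x b + coef y b"
  by (simp add: coef_def representation_add[OF indep_B] span_B)

lemma coef_diff: "coef (x - y) b = coef x b - coef y b"
  by (simp add: coef_def representation_diff[OF indep_B] span_B)

lemma coef_uminus: "coef (- x) b = - coef x b"
  by (simp add: coef_def representation_neg[OF indep_B] span_B)

lemma coef_scale: "coef (c *\<^sub>R x) b = c * coef x b"
  by (simp add: coef_def representation_scale[OF indep_B] span_B)

lemma coef_zero: "coef 0 b = 0"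
  by (simp add: coef_def representation_zero)

lemma coef_basis: "b \<in> B \<Longrightarrow> coef b c = (if c = b then 1 else 0)"
  by (simp add: coef_def representation_basis[OF indep_B])

lemma coef_expand: "(\<Sum>b\<in>B. coef x b *\<^sub>R b) = x"
  unfolding coef_def
  by (rule sum_representation_eq[OF indep_B]) (auto simp: span_B finite_B)

lemma coef_sum: "coef (\<Sum>i\<in>I. f i) b = (\<Sum>i\<in>I. coef (f i) b)"
  by (induction I rule: infinite_finite_induct) (auto simp: coef_zero coef_add)

lemma coef_inner: "x \<bullet> y = (\<Sum>b\<in>B. coef x b * (b \<bullet> y))"
  by (subst coef_expand[of x, symmetric]) (simp add: inner_sum_left)

lemma coef_eqI: "(\<And>b. b \<in> B \<Longrightarrow> coef x b = coef y b) \<Longrightarrow> x = y"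
  by (metis (mono_tags, lifting) coef_expand sum.cong)

lemma nonneg_comb_iff: "nonneg_comb B x \<longleftrightarrow> (\<forall>b\<in>B. coef x b \<in> \<nat>)"
proof
  assume "nonneg_comb B x"
  then obtain c where c: "x = (\<Sum>a\<in>B. real (c a) *\<^sub>R a)" unfolding nonneg_comb_def by auto
  have "coef x b = real (c b)" if "b \<in> B" for b
  proof -
    have "coef x b = (\<Sum>a\<in>B. real (c a) * coef a b)" by (simp add: c coef_sum coef_scale)
    also have "\<dots> = (\<Sum>a\<in>B. if b = a then real (c a) else 0)"
      by (rule sum.cong) (auto simp: coef_basis)
    finally show ?thesis using that finite_B by simp
  qed
  then show "\<forall>b\<in>B. coef x b \<in> \<nat>" by auto
next
  assume *: "\<forall>b\<in>B. coef x b \<in> \<nat>"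
  define c where "c b = nat \<lfloor>coef x b\<rfloor>" for b
  have "real (c b) = coef x b" if "b \<in> B" for b
    using * that unfolding c_def by (auto elim!: Nats_cases)
  then have "x = (\<Sum>b\<in>B. real (c b) *\<^sub>R b)"
    using coef_expand[of x] by simp
  then show "nonneg_comb B x" unfolding nonneg_comb_def by blast
qed

definition pos :: "real ^ 'l \<Rightarrow> bool" where "pos a \<longleftrightarrow> a \<in> R \<and> nonneg_comb B a"

lemma pos_in_R: "pos a \<Longrightarrow> a \<in> R" by (simp add: pos_def)

lemma pos_cases: "a \<in> R \<Longrightarrow> pos a \<or> pos (- a)"
  using pos_or_neg by (auto simp: pos_def root_uminus)

lemma coef_nonneg: "pos a \<Longrightarrow> b \<in> B \<Longrightarrow> coef a b \<ge> 0"
  by (auto simp: pos_def nonneg_comb_iff Nats_def)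

lemma posI: "a \<in> R \<Longrightarrow> b \<in> B \<Longrightarrow> coef a b > 0 \<Longrightarrow> pos a"
  using pos_cases[of a] coef_nonneg[of "-a" b] by (force simp: coef_uminus)

lemma not_pos_uminus: "pos a \<Longrightarrow> \<not> pos (- a)"
proof
  assume a: "pos a" "pos (-a)"
  have "a = 0"
  proof (rule coef_eqI)
    fix b assume "b \<in> B"
    then show "coef a b = coef 0 b" using coef_nonneg[OF a(1), of b] coef_nonneg[OF a(2), of b]
      by (simp add: coef_uminus coef_zero)
  qed
  then show False using a(1) zero_notin_R by (simp add: pos_def)
qed

lemma simple_pos: "b \<in> B \<Longrightarrow> pos b"
  using B_subset by (auto simp: pos_def nonneg_comb_iff coef_basis)

lemma simple_root: "b \<in> B \<Longrightarrow> b \<in> R"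
  using B_subset by auto

lemma coef_Ints: "a \<in> R \<Longrightarrow> b \<in> B \<Longrightarrow> coef a b \<in> \<int>"
  using pos_cases[of a] by (auto simp: pos_def nonneg_comb_iff coef_uminus Nats_subset_Ints[THEN subsetD] dest!: bspec[of _ _ b])
   (metis Ints_minus Nats_subset_Ints add.inverse_inverse subsetD)

lemma coef_reflection:
  "b \<in> B \<Longrightarrow> coef (reflection b x) c = coef x c - (if c = b then cartan x b else 0)"
  by (simp add: reflection_cartan coef_diff coef_scale coef_basis)

text \<open>Since \<open>R\<close> is reduced, \<open>a\<close> is no multiple of \<open>b\<close>,
  so its coefficient at another simple root is positive. Reflection in \<open>b\<close> alters only
  the coefficient at \<open>b\<close>, and one positive coefficient already makes a root
  positive.\<close>

lemma simple_reflection_pos: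
  assumes "b \<in> B" "pos a" "a \<noteq> b"
  shows "pos (reflection b a)"
proof -
  have "\<exists>c\<in>B. c \<noteq> b \<and> coef a c > 0"
  proof (rule ccontr)
    assume "\<not> ?thesis"
    then have z: "coef a c = 0" if "c \<in> B" "c \<noteq> b" for c
      using coef_nonneg[OF assms(2)] that by force
    have "a = coef a b *\<^sub>R b"
      by (rule coef_eqI) (auto simp: coef_scale coef_basis assms z)
    moreover have "coef a b = 1 \<or> coef a b = -1"
      using reduced[of b "coef a b"] calculation assms simple_root pos_in_R by metis
    ultimately show False
      using assms coef_nonneg[OF assms(2,1)] by force
  qed
  then obtain c where "c \<in> B" "c \<noteq> b" "coef a c > 0" by auto
  then show ?thesis
    using assms by (intro posI[of _ c]) (auto simp: coef_reflection reflection_in_R pos_in_R simple_root)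
qed

definition ht :: "real ^ 'l \<Rightarrow> real" where "ht x = (\<Sum>b\<in>B. coef x b)"

lemma ht_reflection: "b \<in> B \<Longrightarrow> ht (reflection b x) = ht x - cartan x b"
  by (simp add: ht_def coef_reflection sum_subtractf finite_B)

lemma ht_Nats: "pos a \<Longrightarrow> ht a \<in> \<nat>"
proof -
  have "sum f A \<in> \<nat>" if "\<forall>b\<in>A. f b \<in> \<nat>" for f :: "real ^ 'l \<Rightarrow> real" and A
    using that by (induction A rule: infinite_finite_induct) auto
  then show "pos a \<Longrightarrow> ht a \<in> \<nat>" unfolding ht_def by (simp add: pos_def nonneg_comb_iff)
qed

lemma cartan_gt_0_iff: "a \<in> R \<Longrightarrow> cartan x a > 0 \<longleftrightarrow> x \<bullet> a > 0"
  using root_nonzero[of a] inner_ge_zero[of a] by (simp add: cartan_def zero_less_divide_iff del: inner_ge_zero)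

lemma cartan_eq_0_iff: "a \<in> R \<Longrightarrow> cartan x a = 0 \<longleftrightarrow> x \<bullet> a = 0"
  using root_nonzero[of a] by (simp add: cartan_def)

lemma cartan_ge_0_iff: "a \<in> R \<Longrightarrow> cartan x a \<ge> 0 \<longleftrightarrow> x \<bullet> a \<ge> 0"
  using root_nonzero[of a] inner_ge_zero[of a] inner_eq_zero_iff[of a] by (auto simp add: cartan_def zero_le_divide_iff simp del: inner_ge_zero inner_eq_zero_iff)

text \<open>Strong induction on height. From \<open>a \<bullet> a > 0\<close>, some simple
  \<open>b\<close> has positive coefficient in \<open>a\<close> and positive inner product with
  \<open>a\<close>; reflecting in it lowers the height, and reflecting back recovers
  \<open>a\<close>.\<close>

lemma pos_root_induct [consumes 1, case_names simple reflect]: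
  assumes "pos a"
    and base: "\<And>b. b \<in> B \<Longrightarrow> Q b"
    and step: "\<And>a b. pos a \<Longrightarrow> b \<in> B \<Longrightarrow> Q a \<Longrightarrow> Q (reflection b a)"
  shows "Q a"
proof -
  obtain n where "ht a = real n" using ht_Nats[OF assms(1)] by (auto elim: Nats_cases)
  then show ?thesis using assms(1)
  proof (induction n arbitrary: a rule: less_induct)
    case (less n)
    show ?case
    proof (cases "a \<in> B")
      case False
      have "a \<bullet> a > 0" using less.prems(2) pos_in_R root_nonzero by auto
      then have "(\<Sum>b\<in>B. coef a b * (b \<bullet> a)) > 0" by (simp add: coef_inner[of a a])
      then obtain b where b: "b \<in> B" "coef a b * (b \<bullet> a) > 0"
        by (meson not_less sum_nonpos)
      then have "b \<bullet> a > 0" using coef_nonneg[OF less.prems(2), of b]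
        by (simp add: zero_less_mult_iff)
      then have c: "cartan a b > 0" using b simple_root cartan_gt_0_iff by (simp add: inner_commute)
      have p: "pos (reflection b a)"
        using simple_reflection_pos[OF b(1) less.prems(2)] False b(1) by auto
      obtain m where m: "ht (reflection b a) = real m"
        using ht_Nats[OF p] by (auto elim: Nats_cases)
      have "m < n" using m c less.prems(1) ht_reflection[OF b(1), of a] by simp
      then have "Q (reflection b a)" using less.IH m p by blast
      from step[OF p b(1) this] show ?thesis by simp
    qed (rule base)
  qed
qed

text \<open>Positive roots and their negatives are treated together; the negative of a simple root
  is reached as \<open>reflection b b\<close>.\<close>

lemma root_induct [consumes 1, case_names simple reflect]:
  assumes "a \<in> R"
    and base: "\<And>b. b \<in> B \<Longrightarrow> Q b"
    and step: "\<And>a b. a \<in> R \<Longrightarrow> b \<in> B \<Longrightarrow> Q a \<Longrightarrow> Q (reflection b a)"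
  shows "Q a"
proof -
  have *: "Q a" "Q (- a)" if "pos a" for a
    using that
  proof (induction rule: pos_root_induct)
    case (simple b)
    { case 1 show ?case using base simple by auto }
    { case 2 show ?case using step[of b b] base simple
        by (simp add: reflection_self simple_root root_nonzero) }
  next
    case (reflect a b)
    { case 1 show ?case using step reflect pos_in_R by auto }
    { case 2 show ?case using step[of "-a" b] reflect pos_in_R root_uminus
        by (simp add: linear_neg[OF linear_reflection]) }
  qed
  show ?thesis using pos_cases[OF assms(1)] *[of a] *[of "-a"] by auto
qed

end

section \<open>Generated subgroups\<close>

lemma group_closure_scaleR_Ints:
  fixes x :: "'a :: real_vector"
  assumes "x \<in> group_closure S" "c \<in> \<int>"
  shows "c *\<^sub>R x \<in> group_closure S"
proof -
  have nat: "real n *\<^sub>R x \<in> group_closure S" for n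
    by (induction n) (auto simp: scaleR_add_left intro!: group_closure_add assms(1))
  obtain i where i: "c = of_int i" using assms(2) by (auto elim: Ints_cases)
  show ?thesis
  proof (cases "i \<ge> 0")
    case True
    then show ?thesis using nat[of "nat i"] i by simp
  next
    case False
    then have "c *\<^sub>R x = - (real (nat (- i)) *\<^sub>R x)" using i by simp
    then show ?thesis using nat by (metis group_closure_minus_iff)
  qed
qed

lemma group_closure_sum:
  fixes f :: "'b \<Rightarrow> 'a :: ab_group_add"
  assumes "\<And>i. i \<in> I \<Longrightarrow> f i \<in> group_closure S"
  shows "sum f I \<in> group_closure S"
  using assms by (induction I rule: infinite_finite_induct) (auto intro: group_closure_add)

lemma group_closure_minimal:
  assumes "S \<subseteq> group_closure T"
  shows "group_closure S \<subseteq> group_closure T"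
proof
  fix x assume "x \<in> group_closure S"
  then show "x \<in> group_closure T"
    by induction (use assms in \<open>auto intro: group_closure.diff\<close>)
qed

text \<open>The coordinate of \<open>x\<close> at \<open>c\<close> is its inner product with a dual
  basis vector, and that vector pairs integrally with all of \<open>C\<close>.\<close>

lemma in_group_closure_if_dual_Ints:
  fixes C :: "'a :: euclidean_space set"
  assumes indep: "independent C" and span: "span C = UNIV"
    and dual: "\<And>y. (\<And>c. c \<in> C \<Longrightarrow> y \<bullet> c \<in> \<int>) \<Longrightarrow> x \<bullet> y \<in> \<int>"
  shows "x \<in> group_closure C"
proof -
  have fin: "finite C" using indep independent_imp_finite by blast
  have "representation C x c \<in> \<int>" if "c \<in> C" for c
  proof -
    define f where "f z = representation C z c" for z
    have lin: "linear f"
      unfolding f_def by (rule linearI) (simp_all add: representation_add[OF indep] representation_scale[OF indep] span)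
    define y where "y = (\<Sum>i\<in>Basis. f i *\<^sub>R i)"
    have y: "z \<bullet> y = f z" for z
    proof -
      have "f z = f (\<Sum>i\<in>Basis. (z \<bullet> i) *\<^sub>R i)" by (simp add: euclidean_representation)
      then show ?thesis
        by (simp add: y_def inner_sum_right linear_sum[OF lin] linear_cmul[OF lin] mult.commute)
    qed
    have "y \<bullet> d \<in> \<int>" if "d \<in> C" for d
      using y[of d] that by (simp add: inner_commute f_def representation_basis[OF indep])
    then have "x \<bullet> y \<in> \<int>" using dual by blast
    then show ?thesis by (simp add: y f_def)
  qed
  then have "(\<Sum>c\<in>C. representation C x c *\<^sub>R c) \<in> group_closure C"
    by (intro group_closure_sum group_closure_scaleR_Ints) (auto intro: group_closure.base)
  then show ?thesis
    using sum_representation_eq[OF indep, of x C] by (simp add: span fin)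
qed

section \<open>The highest root and root lengths\<close>

context root_data
begin

text \<open>The root \<open>reflection b a\<close> is again positive, and its coefficient at
  \<open>b\<close> is \<open>- cartan a b\<close>.\<close>

lemma simple_inner_le_0:
  assumes "a \<in> B" "b \<in> B" "a \<noteq> b"
  shows "a \<bullet> b \<le> 0"
proof -
  have "pos (reflection b a)" using simple_reflection_pos assms simple_pos by blast
  from coef_nonneg[OF this assms(2)] have "cartan a b \<le> 0"
    using assms by (simp add: coef_reflection coef_basis)
  then show ?thesis using cartan_gt_0_iff[of b a] simple_root assms by force
qed

text \<open>Cauchy-Schwarz bounds \<open>cartan a b\<close> by 2 because \<open>b\<close> is at
  least as long, and equality would force \<open>a = b\<close>. Strictly between 0 and 2 only one
  integer is left.\<close>

lemma cartan_eq_1: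
  assumes "a \<in> R" "b \<in> R" "norm a \<le> norm b" "a \<bullet> b > 0" "a \<noteq> b"
  shows "cartan a b = 1"
proof -
  have bb: "b \<bullet> b > 0" using root_nonzero assms by auto
  have "a \<bullet> b \<le> norm a * norm b" by (rule norm_cauchy_schwarz)
  also have "norm a * norm b \<le> norm b * norm b" using assms by (intro mult_right_mono) auto
  finally have le: "a \<bullet> b \<le> norm b * norm b" .
  have "a \<bullet> b \<noteq> b \<bullet> b"
  proof
    assume eq: "a \<bullet> b = b \<bullet> b"
    then have "(a - b) \<bullet> (a - b) = a \<bullet> a - b \<bullet> b"
      by (simp add: inner_diff_left inner_diff_right inner_commute)
    also have "\<dots> \<le> 0" using assms(3) by (simp add: norm_le)
    finally have "(a - b) \<bullet> (a - b) = 0" using inner_ge_zero[of "a - b"] by linarith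
    then show False using assms(5) by simp
  qed
  then have "a \<bullet> b < b \<bullet> b" using le by (simp add: dot_square_norm power2_eq_square)
  then have "cartan a b < 2" using bb by (simp add: cartan_def field_simps)
  moreover have "cartan a b > 0" using cartan_gt_0_iff assms by auto
  moreover have "cartan a b \<in> \<int>" using cartan_Ints assms by auto
  ultimately show ?thesis by (auto elim!: Ints_cases)
qed

text \<open>Reflect the shorter root in the longer one: by \<open>cartan_eq_1\<close> this subtracts
  the longer root exactly once.\<close>

lemma root_diff:
  assumes "a \<in> R" "b \<in> R" "a \<bullet> b > 0" "a \<noteq> b"
  shows "a - b \<in> R"
proof (cases "norm a \<le> norm b")
  case True
  then show ?thesis using cartan_eq_1[OF assms(1,2)] reflection_in_R[OF assms(2,1)] assms
    by (simp add: reflection_cartan)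
next
  case False
  then have "b - a \<in> R" using cartan_eq_1[OF assms(2,1)] reflection_in_R[OF assms(1,2)] assms
    by (simp add: reflection_cartan inner_commute)
  then show ?thesis using root_uminus by fastforce
qed

lemma nonneg_comb_add: "nonneg_comb B x \<Longrightarrow> nonneg_comb B y \<Longrightarrow> nonneg_comb B (x + y)"
  by (simp add: nonneg_comb_iff coef_add)

lemma nonneg_comb_antisym:
  assumes "nonneg_comb B (x - y)" "ht x \<le> ht y"
  shows "x = y"
proof (rule coef_eqI)
  have nn: "coef (x - y) b \<ge> 0" if "b \<in> B" for b
    using assms(1) that by (auto simp: nonneg_comb_iff Nats_def)
  have "(\<Sum>b\<in>B. coef (x - y) b) = ht x - ht y"
    by (simp add: ht_def coef_diff sum_subtractf)
  also have "\<dots> \<le> 0" using assms(2) by simp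
  finally have "(\<Sum>b\<in>B. coef (x - y) b) = 0" using nn by (simp add: sum_nonneg order_antisym)
  then show "coef x b = coef y b" if "b \<in> B" for b
    using that sum_nonneg_eq_0_iff[OF finite_B nn] by (simp add: coef_diff)
qed

text \<open>Let \<open>J\<close> be the support of \<open>a\<close>. Distinct simple roots have
  nonpositive inner products, so dominance forces every simple root outside \<open>J\<close> to be
  orthogonal to \<open>J\<close>. Then each root is supported inside or outside \<open>J\<close>,
  the two kinds are orthogonal, and irreducibility leaves only the first.\<close>

lemma full_support_if_dominant:
  assumes "pos a" "\<And>b. b \<in> B \<Longrightarrow> a \<bullet> b \<ge> 0" "c \<in> B"
  shows "coef a c > 0"
proof -
  define J where "J = {b \<in> B. coef a b > 0}"
  have J0: "coef a b = 0" if "b \<in> B - J" for b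
    using that coef_nonneg[OF assms(1), of b] by (auto simp: J_def)
  have orth: "i \<bullet> j = 0" if "i \<in> B - J" "j \<in> J" for i j
  proof -
    have terms: "coef a b * (b \<bullet> i) \<le> 0" if "b \<in> B" for b
      using simple_inner_le_0[of b i] coef_nonneg[OF assms(1) that] J0[of i] \<open>i \<in> B - J\<close> that
      by (cases "b = i") (auto simp: mult_nonneg_nonpos)
    have "(\<Sum>b\<in>B. - (coef a b * (b \<bullet> i))) = - (a \<bullet> i)"
      by (simp add: coef_inner[of a i] sum_negf)
    also have "\<dots> \<le> 0" using assms(2) that by auto
    finally have "(\<Sum>b\<in>B. - (coef a b * (b \<bullet> i))) = 0"
      using terms by (intro antisym sum_nonneg) auto
    then have "\<forall>b\<in>B. - (coef a b * (b \<bullet> i)) = 0"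
      using sum_nonneg_eq_0_iff[OF finite_B, of "\<lambda>b. - (coef a b * (b \<bullet> i))"] terms by auto
    then show ?thesis using that by (auto simp: J_def inner_commute)
  qed
  define R1 where "R1 = {r \<in> R. \<forall>b\<in>B - J. coef r b = 0}"
  define R2 where "R2 = {r \<in> R. \<forall>b\<in>J. coef r b = 0}"
  have JB: "J \<subseteq> B" by (auto simp: J_def)
  \<comment> \<open>Simple reflections reach all roots from \<open>B\<close>. One in the block of
    \<open>r\<close> changes a coefficient inside that block, one in the other block fixes
    \<open>r\<close>.\<close>
  have "r \<in> R1 \<union> R2" if "r \<in> R" for r
    using that
  proof (induction rule: root_induct)
    case (simple b)
    then show ?case by (auto simp: R1_def R2_def coef_basis simple_root)
  next
    case (reflect r b)
    have zero1: "r \<bullet> b = 0" if "r \<in> R1" "b \<in> B - J"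
      unfolding coef_inner[of r b] using that orth[of b]
      by (intro sum.neutral) (auto simp: R1_def inner_commute)
    have zero2: "r \<bullet> b = 0" if "r \<in> R2" "b \<in> J"
      unfolding coef_inner[of r b] using that orth[of _ b]
      by (intro sum.neutral) (auto simp: R2_def)
    consider "r \<in> R1" "b \<in> J" | "r \<in> R1" "b \<in> B - J" | "r \<in> R2" "b \<in> J" | "r \<in> R2" "b \<in> B - J"
      using reflect by blast
    then show ?case
    proof cases
      case 2 then show ?thesis using zero1 by (simp add: reflection_def)
    next
      case 3 then show ?thesis using zero2 by (simp add: reflection_def)
    qed (use reflect in \<open>auto simp: R1_def R2_def coef_reflection reflection_in_R simple_root\<close>)
  qed
  then have "R1 \<union> R2 = R" by (auto simp: R1_def R2_def)
  moreover have "r \<bullet> s = 0" if "r \<in> R1" "s \<in> R2" for r s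
  proof -
    have "coef r i * (i \<bullet> s) = 0" if i: "i \<in> B" for i
    proof (cases "i \<in> J")
      case True
      have "s \<bullet> i = 0" unfolding coef_inner[of s i]
        using \<open>s \<in> R2\<close> True orth[of _ i] by (intro sum.neutral) (auto simp: R2_def)
      then show ?thesis by (simp add: inner_commute)
    qed (use \<open>r \<in> R1\<close> i in \<open>auto simp: R1_def\<close>)
    then show ?thesis unfolding coef_inner[of r s] by (intro sum.neutral) auto
  qed
  moreover have "R1 \<noteq> {}"
    using assms(1) J0 by (auto simp: R1_def pos_def)
  ultimately have R2: "R2 = {}" using orthogonal_split_trivial by metis
  have "c \<in> J"
  proof (rule ccontr)
    assume "c \<notin> J"
    then have "c \<in> R2" using assms(3) JB by (auto simp: R2_def simple_root coef_basis)
    with R2 show False by simp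
  qed
  then show ?thesis by (simp add: J_def)
qed

section \<open>Existence and length of the highest root\<close>

definition maximal_root :: "real ^ 'l \<Rightarrow> bool" where
  "maximal_root a \<longleftrightarrow> a \<in> R \<and> (\<forall>r\<in>R. nonneg_comb B (r - a) \<longrightarrow> r = a)"

text \<open>A negative Cartan integer would let the simple reflection raise \<open>a\<close> in the
  root order.\<close>

lemma maximal_root_dominant:
  assumes "maximal_root a" "b \<in> B"
  shows "a \<bullet> b \<ge> 0"
proof (rule ccontr)
  assume "\<not> ?thesis"
  then have neg: "cartan a b < 0"
    using cartan_ge_0_iff[of b a] assms simple_root by force
  have aR: "a \<in> R" using assms by (simp add: maximal_root_def)
  obtain n where n: "cartan a b = of_int n"
    using cartan_Ints[OF simple_root[OF assms(2)] aR] by (auto elim: Ints_cases)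
  have "reflection b a - a = real (nat (- n)) *\<^sub>R b"
    using neg n by (simp add: reflection_cartan)
  then have "nonneg_comb B (reflection b a - a)"
    using assms(2) unfolding nonneg_comb_iff by (simp add: coef_scale coef_basis)
  then have "reflection b a = a"
    using assms reflection_in_R[OF simple_root aR] by (auto simp: maximal_root_def)
  then show False using neg assms simple_root root_nonzero by (auto simp: reflection_cartan)
qed

lemma maximal_root_pos:
  assumes "maximal_root a"
  shows "pos a"
proof (rule ccontr)
  have aR: "a \<in> R" using assms by (simp add: maximal_root_def)
  assume "\<not> pos a"
  then have "nonneg_comb B (- a)" using pos_cases[OF aR] by (auto simp: pos_def)
  from nonneg_comb_add[OF this this] have "nonneg_comb B (- a - a)" by simp
  then have "- a = a" using assms root_uminus[OF aR] by (auto simp: maximal_root_def)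
  then show False using root_nonzero[OF aR] by (auto simp: vec_eq_iff)
qed

lemma maximal_root_above:
  assumes "a \<in> R"
  obtains m where "maximal_root m" "nonneg_comb B (m - a)"
proof -
  define U where "U = {r \<in> R. nonneg_comb B (r - a)}"
  have "finite U" "a \<in> U"
    using finite_R assms by (auto simp: U_def nonneg_comb_iff coef_zero)
  then have "Max (ht ` U) \<in> ht ` U" by (intro Max_in) auto
  then obtain m where m: "m \<in> U" "ht m = Max (ht ` U)" by auto
  have "r = m" if "r \<in> R" "nonneg_comb B (r - m)" for r
  proof (rule nonneg_comb_antisym[OF that(2)])
    have "nonneg_comb B ((r - m) + (m - a))"
      using that m(1) by (intro nonneg_comb_add) (auto simp: U_def)
    then have "r \<in> U" using that by (simp add: U_def)
    then show "ht r \<le> ht m" using m \<open>finite U\<close> by simp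
  qed
  then show ?thesis using that m(1) by (auto simp: maximal_root_def U_def)
qed

text \<open>Full support of \<open>a\<close> and dominance of \<open>b\<close> give
  \<open>a \<bullet> b > 0\<close>, so \<open>a - b\<close> would be a root; whichever its sign, one
  of the two would lie strictly below the other. With \<open>maximal_root_above\<close> this makes
  the maximal root the greatest one, as \<open>highest_root\<close> demands.\<close>

lemma maximal_root_unique:
  assumes a: "maximal_root a" and b: "maximal_root b"
  shows "a = b"
proof (rule ccontr)
  assume ne: "a \<noteq> b"
  have aR: "a \<in> R" and bR: "b \<in> R" using a b by (auto simp: maximal_root_def)
  have terms: "coef a i * (i \<bullet> b) \<ge> 0" if "i \<in> B" for i
    using coef_nonneg[OF maximal_root_pos[OF a] that] maximal_root_dominant[OF b that]
    by (simp add: inner_commute)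
  have "a \<bullet> b > 0"
  proof (rule ccontr)
    assume "\<not> ?thesis"
    then have "(\<Sum>i\<in>B. coef a i * (i \<bullet> b)) = 0"
      using terms sum_nonneg[of B "\<lambda>i. coef a i * (i \<bullet> b)"] by (simp add: coef_inner[of a b])
    then have "\<forall>i\<in>B. coef a i * (i \<bullet> b) = 0"
      using sum_nonneg_eq_0_iff[OF finite_B, of "\<lambda>i. coef a i * (i \<bullet> b)"] terms by auto
    moreover have "coef a i > 0" if "i \<in> B" for i
      using full_support_if_dominant[OF maximal_root_pos[OF a] maximal_root_dominant[OF a] that] .
    ultimately have "i \<bullet> b = 0" if "i \<in> B" for i using that by fastforce
    then have "b \<bullet> b = 0" using coef_inner[of b b] by simp
    then show False using root_nonzero[OF bR] by simp
  qed
  then have d: "a - b \<in> R" using root_diff aR bR ne by blast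
  from pos_cases[OF d] show False
  proof
    assume "pos (a - b)"
    then show False using b aR ne by (auto simp: pos_def maximal_root_def)
  next
    assume "pos (- (a - b))"
    then show False using a bR ne by (auto simp: pos_def maximal_root_def)
  qed
qed

abbreviation hr ("\<theta>") where "\<theta> \<equiv> highest_root R B"

lemma R_nonempty: "R \<noteq> {}"
proof
  assume "R = {}"
  then have "(UNIV :: (real ^ 'l) set) = {0}" using span_R by simp
  moreover have "axis undefined 1 \<noteq> (0 :: real ^ 'l)" by simp
  ultimately show False by blast
qed

lemma highest_root: "\<theta> \<in> R" "a \<in> R \<Longrightarrow> nonneg_comb B (\<theta> - a)" and maximal_highest_root: "maximal_root \<theta>"
proof -
  obtain r where "r \<in> R" using R_nonempty by blast
  then obtain m where m: "maximal_root m" using maximal_root_above by blast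
  have "nonneg_comb B (m - a)" if "a \<in> R" for a
    using maximal_root_above[OF that] maximal_root_unique[OF m] by metis
  then have P: "m \<in> R \<and> (\<forall>a\<in>R. nonneg_comb B (m - a))"
    using m by (simp add: maximal_root_def)
  have "\<theta> = m"
    unfolding highest_root_def
  proof (rule the_equality)
    show "m \<in> R \<and> (\<forall>a\<in>R. nonneg_comb B (m - a))" by (rule P)
  next
    fix t assume t: "t \<in> R \<and> (\<forall>a\<in>R. nonneg_comb B (t - a))"
    then show "t = m" using m P unfolding maximal_root_def by blast
  qed
  then show "\<theta> \<in> R" "a \<in> R \<Longrightarrow> nonneg_comb B (\<theta> - a)" "maximal_root \<theta>" using P m by auto
qed

lemma pos_highest: "pos \<theta>" and highest_dominant: "b \<in> B \<Longrightarrow> \<theta> \<bullet> b \<ge> 0"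
  using maximal_highest_root maximal_root_pos maximal_root_dominant by blast+

lemma dominant_inner_pos:
  assumes "pos a" "\<And>b. b \<in> B \<Longrightarrow> x \<bullet> b \<ge> 0"
  shows "x \<bullet> a \<ge> 0"
proof -
  have "(\<Sum>b\<in>B. coef a b * (b \<bullet> x)) \<ge> 0"
    using assms by (intro sum_nonneg mult_nonneg_nonneg) (auto simp: coef_nonneg inner_commute)
  then show ?thesis by (simp add: coef_inner[of a x] inner_commute[of x])
qed

lemma dominant_inner_nonneg_comb:
  assumes "nonneg_comb B a" "\<And>b. b \<in> B \<Longrightarrow> x \<bullet> b \<ge> 0"
  shows "x \<bullet> a \<ge> 0"
proof -
  have "(\<Sum>b\<in>B. coef a b * (b \<bullet> x)) \<ge> 0"
    using assms by (intro sum_nonneg mult_nonneg_nonneg) (auto simp: nonneg_comb_iff inner_commute Nats_def)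
  then show ?thesis by (simp add: coef_inner[of a x] inner_commute[of x])
qed

text \<open>Among the roots of greatest length take \<open>m\<close> of greatest height; simple
  reflections keep the length, so \<open>m\<close> is dominant. Pairing \<open>\<theta> - m\<close>
  with \<open>m\<close> and with \<open>\<theta>\<close> gives \<open>m \<bullet> m \<le> \<theta>
  \<bullet> m \<le> \<theta> \<bullet> \<theta>\<close>.\<close>

lemma norm_le_highest:
  assumes "a \<in> R"
  shows "norm a \<le> norm \<theta>"
proof -
  define U where "U = {r \<in> R. \<forall>s\<in>R. norm s \<le> norm r}"
  have "finite U" using finite_R by (simp add: U_def)
  have "Max (norm ` R) \<in> norm ` R" using finite_R R_nonempty by (intro Max_in) auto
  then obtain r where "r \<in> R" "norm r = Max (norm ` R)" by auto
  then have "r \<in> U" using finite_R by (simp add: U_def)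
  then have "Max (ht ` U) \<in> ht ` U" using \<open>finite U\<close> by (intro Max_in) auto
  then obtain m where m: "m \<in> U" "ht m = Max (ht ` U)" by auto
  have mR: "m \<in> R" using m by (simp add: U_def)
  have dom: "m \<bullet> b \<ge> 0" if "b \<in> B" for b
  proof (rule ccontr)
    assume "\<not> ?thesis"
    then have "cartan m b < 0" using cartan_ge_0_iff[of b m] simple_root[OF that] by force
    then have "ht (reflection b m) > ht m" using ht_reflection[OF that] by simp
    moreover have "reflection b m \<in> U"
      using m(1) that by (auto simp: U_def norm_eq_sqrt_inner reflection_in_R simple_root)
    then have "ht (reflection b m) \<le> ht m" using m(2) \<open>finite U\<close> by simp
    ultimately show False by simp
  qed
  have nn: "nonneg_comb B (\<theta> - m)" using highest_root(2)[OF mR] .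
  have "m \<bullet> (\<theta> - m) \<ge> 0" "\<theta> \<bullet> (\<theta> - m) \<ge> 0"
    using dominant_inner_nonneg_comb[OF nn] dom highest_dominant by blast+
  then have "m \<bullet> m \<le> \<theta> \<bullet> \<theta>" by (simp add: inner_diff_right inner_commute)
  then have "norm m \<le> norm \<theta>" by (simp add: norm_le)
  moreover have "norm a \<le> norm m" using m(1) assms by (simp add: U_def)
  ultimately show ?thesis by simp
qed

section \<open>Pairings with long roots and integral length ratios\<close>

lemma cartan_highest:
  assumes "pos a" "a \<noteq> \<theta>"
  shows "cartan a \<theta> = 0 \<or> cartan a \<theta> = 1"
proof -
  have "\<theta> \<bullet> a \<ge> 0" using dominant_inner_pos[OF assms(1)] highest_dominant by blast
  then show ?thesis
    using cartan_eq_1[of a \<theta>] cartan_eq_0_iff[of \<theta> a] assms pos_in_R highest_root(1) norm_le_highest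
    by (force simp: inner_commute)
qed

text \<open>Roots meeting \<open>T\<close> and roots orthogonal to \<open>T\<close> split
  \<open>R\<close>: if \<open>t \<bullet> a \<noteq> 0\<close>, then \<open>a\<close> is a multiple
  of \<open>t - reflection a t\<close>, hence orthogonal to whatever is orthogonal to
  \<open>T\<close>. It serves to find a long root not orthogonal to a given one.\<close>

lemma reflection_closed_meets:
  assumes "T \<subseteq> R" "T \<noteq> {}" "\<And>t r. t \<in> T \<Longrightarrow> r \<in> R \<Longrightarrow> reflection r t \<in> T" "r \<in> R"
  obtains t where "t \<in> T" "t \<bullet> r \<noteq> 0"
proof -
  define R1 where "R1 = {r \<in> R. \<exists>t\<in>T. t \<bullet> r \<noteq> 0}"
  define R2 where "R2 = {r \<in> R. \<forall>t\<in>T. t \<bullet> r = 0}"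
  have "R1 \<union> R2 = R" by (auto simp: R1_def R2_def)
  moreover have "a \<bullet> b = 0" if a: "a \<in> R1" and b: "b \<in> R2" for a b
  proof -
    obtain t where t: "t \<in> T" "t \<bullet> a \<noteq> 0" and aR: "a \<in> R" using a by (auto simp: R1_def)
    have "reflection a t \<in> T" using assms(3) t aR by blast
    then have "reflection a t \<bullet> b = 0" "t \<bullet> b = 0" using b t by (auto simp: R2_def)
    then show ?thesis using t cartan_eq_0_iff[OF aR, of t] by (simp add: reflection_cartan inner_diff_left)
  qed
  moreover have "R1 \<noteq> {}"
  proof -
    obtain t where "t \<in> T" using assms by blast
    then have "t \<in> R1" using assms(1) root_nonzero by (auto simp: R1_def intro!: bexI[of _ t])
    then show ?thesis by blast
  qed
  ultimately have "R2 = {}" using orthogonal_split_trivial by metis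
  then show ?thesis using that assms(4) by (auto simp: R2_def)
qed

lemma cartan_long:
  assumes "t \<in> R" "norm t = norm \<theta>" "r \<in> R" "t \<bullet> r \<noteq> 0" "r \<noteq> t" "r \<noteq> - t"
  shows "cartan r t = 1 \<or> cartan r t = -1"
proof (cases "r \<bullet> t > 0")
  case True
  then show ?thesis using cartan_eq_1[of r t] assms norm_le_highest by auto
next
  case False
  then have "r \<bullet> (- t) > 0" using assms(4) by (simp add: inner_commute)
  then have "cartan r (- t) = 1"
    using cartan_eq_1[of r "- t"] assms norm_le_highest root_uminus by auto
  then show ?thesis by (simp add: cartan_minus_right)
qed

text \<open>The factor by which \<open>nu_coroot\<close> rescales a root:
  \<open>cr a = ratio a *\<^sub>R a\<close>.\<close>

definition ratio :: "real ^ 'l \<Rightarrow> real" where "ratio a = (\<theta> \<bullet> \<theta>) / (a \<bullet> a)"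

lemma ratio_pos: "a \<in> R \<Longrightarrow> ratio a > 0"
  using root_nonzero highest_root(1) by (simp add: ratio_def)

text \<open>Take a long root \<open>t\<close> not orthogonal to \<open>r\<close>. Unless
  \<open>r\<close> is \<open>t\<close> or \<open>- t\<close>, the Cartan integer
  \<open>cartan r t\<close> is 1 or -1, and \<open>cartan t r\<close> is \<open>ratio r\<close>
  times it.\<close>

lemma ratio_Ints:
  assumes "r \<in> R"
  shows "ratio r \<in> \<int>"
proof -
  define T where "T = {t \<in> R. norm t = norm \<theta>}"
  obtain t where t: "t \<in> T" "t \<bullet> r \<noteq> 0"
  proof (rule reflection_closed_meets[OF _ _ _ assms, of T])
    show "T \<noteq> {}" using highest_root by (auto simp: T_def)
  qed (auto simp: T_def norm_eq_sqrt_inner reflection_in_R)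
  have tR: "t \<in> R" and nt: "norm t = norm \<theta>" using t by (auto simp: T_def)
  have tt: "t \<bullet> t = \<theta> \<bullet> \<theta>" using nt by (simp add: norm_eq)
  show ?thesis
  proof (cases "r = t \<or> r = - t")
    case True
    then have "ratio r = 1" using tt root_nonzero[OF highest_root(1)] by (auto simp: ratio_def)
    then show ?thesis by simp
  next
    case False
    have "r \<bullet> r \<noteq> 0" "t \<bullet> t \<noteq> 0" using root_nonzero tR assms by auto
    then have eq: "cartan t r = ratio r * cartan r t"
      by (simp add: cartan_def ratio_def tt[symmetric] inner_commute)
    have "cartan r t = 1 \<or> cartan r t = -1" using cartan_long[OF tR nt assms t(2)] False by auto
    then have "ratio r = cartan t r \<or> ratio r = - cartan t r" using eq by auto
    then show ?thesis using cartan_Ints[OF assms tR] by (auto simp: Ints_minus)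
  qed
qed

section \<open>Lattices, Weyl vector and Weyl group\<close>

abbreviation nf where "nf \<equiv> nform R B"
abbreviation cr where "cr \<equiv> nu_coroot R B"
abbreviation P where "P \<equiv> weight_lattice R B"
abbreviation M where "M \<equiv> coroot_lattice R B"
abbreviation Q where "Q \<equiv> root_lattice R"
abbreviation W where "W \<equiv> weyl_group R"
abbreviation rho ("\<rho>") where "\<rho> \<equiv> weyl_vector R B"

lemma highest_norm_pos: "\<theta> \<bullet> \<theta> > 0"
  using root_nonzero[OF highest_root(1)] by simp

lemma nf_add_left: "nf (x + y) z = nf x z + nf y z"
  and nf_add_right: "nf z (x + y) = nf z x + nf z y"
  and nf_diff_left: "nf (x - y) z = nf x z - nf y z"
  and nf_diff_right: "nf z (x - y) = nf z x - nf z y"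
  and nf_scale_left: "nf (c *\<^sub>R x) z = c * nf x z"
  and nf_scale_right: "nf z (c *\<^sub>R x) = c * nf z x"
  and nf_minus_left: "nf (- x) z = - nf x z"
  and nf_minus_right: "nf z (- x) = - nf z x"
  and nf_zero_left: "nf 0 z = 0"
  and nf_zero_right: "nf z 0 = 0"
  by (simp_all add: nform_def inner_add_left inner_add_right inner_diff_left inner_diff_right
      add_divide_distrib diff_divide_distrib distrib_left right_diff_distrib)

lemmas nf_simps = nf_add_left nf_add_right nf_diff_left nf_diff_right nf_scale_left nf_scale_right
  nf_minus_left nf_minus_right nf_zero_left nf_zero_right

lemma nf_commute: "nf x y = nf y x"
  by (simp add: nform_def inner_commute)

lemma nf_pos_iff: "nf x y > 0 \<longleftrightarrow> x \<bullet> y > 0" and nf_nonneg_iff: "nf x y \<ge> 0 \<longleftrightarrow> x \<bullet> y \<ge> 0"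
  using highest_norm_pos by (simp_all add: nform_def zero_less_divide_iff zero_le_divide_iff del: inner_gt_zero_iff inner_ge_zero)

lemma cr_eq: "a \<in> R \<Longrightarrow> cr a = ratio a *\<^sub>R a"
  using root_nonzero[of a] highest_norm_pos by (simp add: nu_coroot_def nform_def ratio_def)

lemma nf_cr: "a \<in> R \<Longrightarrow> nf x (cr a) = cartan x a"
  using root_nonzero[of a] highest_norm_pos
  by (simp add: cr_eq nf_scale_right) (simp add: nform_def ratio_def cartan_def)

lemma cr_highest: "cr \<theta> = \<theta>"
  using highest_norm_pos highest_root(1) by (simp add: cr_eq ratio_def)

lemma nf_highest: "nf x \<theta> = cartan x \<theta>"
  using nf_cr[OF highest_root(1), of x] by (simp add: cr_highest)

lemma cartan_ratio: "a \<in> R \<Longrightarrow> cartan x a = ratio a * nf x a"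
  using nf_cr[of a x] by (simp add: cr_eq nf_scale_right)

lemma reflection_cr: "a \<in> R \<Longrightarrow> reflection a x = x - nf x a *\<^sub>R cr a"
  by (simp add: reflection_cartan cartan_ratio cr_eq mult.commute)

lemma cr_orthogonal:
  assumes "linear g" "\<And>x y. g x \<bullet> g y = x \<bullet> y"
  shows "cr (g a) = g (cr a)"
  by (simp add: nu_coroot_def nform_def assms linear_cmul)

lemma cr_reflection: "cr (reflection b a) = reflection b (cr a)"
  by (intro cr_orthogonal linear_reflection inner_reflection)

text \<open>Reflection in \<open>b\<close> permutes the positive roots other than \<open>b\<close>
  and negates \<open>b\<close>, so the sum of all positive roots drops by
  \<open>2 b\<close>.\<close>

lemma reflection_rho:
  assumes "b \<in> B"
  shows "reflection b \<rho> = \<rho> - b"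
proof -
  let ?P = "pos_roots R B"
  have P: "?P = {a. pos a}" by (auto simp: pos_roots_def pos_def)
  have fin: "finite ?P" using finite_R by (simp add: pos_roots_def)
  have bP: "b \<in> ?P" using assms simple_pos P by auto
  have bij: "bij_betw (reflection b) (?P - {b}) (?P - {b})"
  proof (rule bij_betwI[where g = "reflection b"])
    have "reflection b a \<noteq> b" if "pos a" for a
    proof
      assume "reflection b a = b"
      then have "a = reflection b b" by (metis reflection_reflection)
      then have "a = - b" using reflection_self[OF root_nonzero[OF simple_root[OF assms]]] by simp
      then show False using that not_pos_uminus[of b] simple_pos assms by auto
    qed
    then show "reflection b \<in> ?P - {b} \<rightarrow> ?P - {b}"
      using simple_reflection_pos[OF assms] by (auto simp: P)
    then show "reflection b \<in> ?P - {b} \<rightarrow> ?P - {b}" .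
  qed simp_all
  have "reflection b (\<Sum>a\<in>?P - {b}. a) = (\<Sum>a\<in>?P - {b}. reflection b a)"
    by (rule linear_sum[OF linear_reflection])
  also have "\<dots> = (\<Sum>a\<in>?P - {b}. a)"
    using sum.reindex_bij_betw[OF bij, of "\<lambda>a. a"] .
  finally have rest: "reflection b (\<Sum>a\<in>?P - {b}. a) = (\<Sum>a\<in>?P - {b}. a)" .
  have split: "(\<Sum>a\<in>?P. a) = b + (\<Sum>a\<in>?P - {b}. a)"
    by (rule sum.remove[OF fin bP])
  have "reflection b (\<Sum>a\<in>?P. a) = (\<Sum>a\<in>?P. a) - 2 *\<^sub>R b"
    unfolding split linear_add[OF linear_reflection] rest
    using reflection_self[OF root_nonzero[OF simple_root[OF assms]]] by (simp add: scaleR_2)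
  then show ?thesis
    by (simp add: weyl_vector_def linear_cmul[OF linear_reflection] scaleR_diff_right)
qed

lemma cartan_rho: "b \<in> B \<Longrightarrow> cartan \<rho> b = 1"
  using reflection_rho[of b] root_nonzero[OF simple_root, of b] scaleR_cancel_right[of "cartan \<rho> b" b 1]
  by (simp add: reflection_cartan)

text \<open>The second argument enters linearly through its coroot, and reflecting \<open>a\<close>
  reflects \<open>cr a\<close>. Thus integrality on \<open>B\<close> spreads to all roots by
  \<open>root_induct\<close>.\<close>

lemma cartan_reflection:
  assumes "a \<in> R" "b \<in> R"
  shows "cartan x (reflection b a) = cartan x a - cartan b a * cartan x b"
proof -
  have "cartan x (reflection b a) = nf x (reflection b (cr a))"
    using nf_cr[OF reflection_in_R[OF assms(2,1)]] by (simp add: cr_reflection)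
  also have "\<dots> = nf x (cr a) - nf (cr a) b * nf x (cr b)"
    by (simp add: reflection_cr[OF assms(2)] nf_simps)
  finally show ?thesis using assms nf_commute[of "cr a" b] by (simp add: nf_cr)
qed

lemma P_iff: "x \<in> P \<longleftrightarrow> (\<forall>a\<in>R. cartan x a \<in> \<int>)"
  by (simp add: weight_lattice_def nf_cr)

lemma P_iff_simple: "x \<in> P \<longleftrightarrow> (\<forall>a\<in>B. cartan x a \<in> \<int>)"
proof
  assume *: "\<forall>a\<in>B. cartan x a \<in> \<int>"
  have "cartan x a \<in> \<int>" if "a \<in> R" for a
    using that
  proof (induction rule: root_induct)
    case (reflect a b)
    then show ?case using * cartan_Ints simple_root by (simp add: cartan_reflection)
  qed (use * in auto)
  then show "x \<in> P" by (simp add: P_iff)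
qed (simp add: P_iff simple_root)

lemma rho_P: "\<rho> \<in> P"
  by (simp add: P_iff_simple cartan_rho)

lemma P_zero: "0 \<in> P" and P_add: "x \<in> P \<Longrightarrow> y \<in> P \<Longrightarrow> x + y \<in> P"
  and P_diff: "x \<in> P \<Longrightarrow> y \<in> P \<Longrightarrow> x - y \<in> P" and P_minus: "x \<in> P \<Longrightarrow> - x \<in> P"
  and P_scale: "c \<in> \<int> \<Longrightarrow> x \<in> P \<Longrightarrow> c *\<^sub>R x \<in> P"
  using cartan_diff[of 0 x]
  by (simp_all add: P_iff cartan_add cartan_diff cartan_scaleR) (simp_all add: cartan_def)

lemma root_lattice_simple: "Q = group_closure B"
proof
  have "r \<in> group_closure B" if "r \<in> R" for r
  proof -
    have "(\<Sum>b\<in>B. coef r b *\<^sub>R b) \<in> group_closure B"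
      by (intro group_closure_sum group_closure_scaleR_Ints coef_Ints that)
         (auto intro: group_closure.base)
    then show ?thesis by (simp add: coef_expand)
  qed
  then show "Q \<subseteq> group_closure B"
    unfolding root_lattice_def by (intro group_closure_minimal) auto
  show "group_closure B \<subseteq> Q"
    unfolding root_lattice_def using simple_root
    by (intro group_closure_minimal) (auto intro: group_closure.base)
qed

lemma coroot_lattice_simple: "M = group_closure (cr ` B)"
proof
  have "cr r \<in> group_closure (cr ` B)" if "r \<in> R" for r
    using that
  proof (induction rule: root_induct)
    case (reflect a b)
    have bR: "b \<in> R" using reflect simple_root by blast
    have "nf (cr a) b \<in> \<int>"
      using nf_cr[of a b] cartan_Ints[of a b] reflect bR by (simp add: nf_commute)
    then have "cr a - nf (cr a) b *\<^sub>R cr b \<in> group_closure (cr ` B)"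
      using reflect by (intro group_closure.diff group_closure_scaleR_Ints) (auto intro: group_closure.base)
    then show ?case using reflection_cr[OF bR, of "cr a"] by (simp add: cr_reflection)
  qed (auto intro: group_closure.base)
  then show "M \<subseteq> group_closure (cr ` B)"
    unfolding coroot_lattice_def by (intro group_closure_minimal) auto
  show "group_closure (cr ` B) \<subseteq> M"
    unfolding coroot_lattice_def using simple_root
    by (intro group_closure_minimal) (auto intro: group_closure.base)
qed

lemma M_add: "x \<in> M \<Longrightarrow> y \<in> M \<Longrightarrow> x + y \<in> M" and M_diff: "x \<in> M \<Longrightarrow> y \<in> M \<Longrightarrow> x - y \<in> M"
  and M_minus: "x \<in> M \<Longrightarrow> - x \<in> M" and M_zero: "0 \<in> M" and M_coroot: "a \<in> R \<Longrightarrow> cr a \<in> M"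
  and M_scale: "c \<in> \<int> \<Longrightarrow> x \<in> M \<Longrightarrow> c *\<^sub>R x \<in> M"
  unfolding coroot_lattice_def
  by (auto intro: group_closure_add group_closure.diff group_closure.base group_closure_scaleR_Ints)

lemma Q_add: "x \<in> Q \<Longrightarrow> y \<in> Q \<Longrightarrow> x + y \<in> Q" and Q_diff: "x \<in> Q \<Longrightarrow> y \<in> Q \<Longrightarrow> x - y \<in> Q"
  and Q_minus: "x \<in> Q \<Longrightarrow> - x \<in> Q" and Q_zero: "0 \<in> Q" and Q_root: "a \<in> R \<Longrightarrow> a \<in> Q"
  and Q_scale: "c \<in> \<int> \<Longrightarrow> x \<in> Q \<Longrightarrow> c *\<^sub>R x \<in> Q"
  unfolding root_lattice_def
  by (auto intro: group_closure_add group_closure.diff group_closure.base group_closure_scaleR_Ints)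

lemma nf_P_M: "x \<in> P \<Longrightarrow> m \<in> M \<Longrightarrow> nf x m \<in> \<int>"
  unfolding coroot_lattice_def
  by (rotate_tac, induction rule: group_closure.induct) (auto simp: nf_simps P_iff nf_cr)

lemma P_dual: "dual_lattice R B M = P"
  using nf_P_M by (auto simp: dual_lattice_def weight_lattice_def M_coroot)

lemma Q_subset_P: "Q \<subseteq> P"
proof
  fix x assume "x \<in> Q"
  then show "x \<in> P" unfolding root_lattice_def
    by (induction rule: group_closure.induct) (auto simp: P_zero P_diff, simp add: P_iff cartan_Ints)
qed

lemma M_subset_P: "M \<subseteq> P"
proof -
  have *: "cr a \<in> P" if "a \<in> R" for a
    using that by (simp add: cr_eq P_scale ratio_Ints P_iff[of a] cartan_Ints)
  have "x \<in> P" if "x \<in> M" for x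
    using that unfolding coroot_lattice_def
    by (induction rule: group_closure.induct) (auto simp: P_zero P_diff *)
  then show ?thesis by blast
qed

lemma simple_coroots_basis: "independent (cr ` B)" "span (cr ` B) = UNIV"
proof -
  have "b \<in> span (cr ` B)" if "b \<in> B" for b
  proof -
    have "b = (1 / ratio b) *\<^sub>R cr b"
      using ratio_pos[OF simple_root[OF that]] by (simp add: cr_eq simple_root that)
    then show ?thesis using span_scale[OF span_base[of "cr b" "cr ` B"]] that by (metis imageI)
  qed
  then have "span B \<subseteq> span (cr ` B)" by (intro span_minimal) auto
  then show sp: "span (cr ` B) = UNIV" using span_B by auto
  have "card (cr ` B) \<le> card B" using finite_B card_image_le by blast
  also have "\<dots> = dim (UNIV :: (real ^ 'l) set)"
    using dim_span_eq_card_independent[OF indep_B] span_B by simp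
  finally show "independent (cr ` B)"
    using card_le_dim_spanning[of "cr ` B" UNIV] sp finite_B by auto
qed

text \<open>The harder half of the duality between \<open>M\<close> and \<open>P\<close>:
  \<open>M\<close> is spanned by the simple coroots, whose dual basis lies in \<open>P\<close> and
  serves as test vectors.\<close>

lemma in_M_if_dual:
  assumes "\<And>y. y \<in> P \<Longrightarrow> nf x y \<in> \<int>"
  shows "x \<in> M"
  unfolding coroot_lattice_simple
proof (rule in_group_closure_if_dual_Ints[OF simple_coroots_basis])
  fix y :: "real ^ 'l" assume y: "\<And>c. c \<in> cr ` B \<Longrightarrow> y \<bullet> c \<in> \<int>"
  \<comment> \<open>The rescaling turns the standard inner product with \<open>y\<close> into the
    normalized form with \<open>z\<close>.\<close>
  define z where "z = ((\<theta> \<bullet> \<theta>) / 2) *\<^sub>R y"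
  have z: "nf u z = u \<bullet> y" for u
    using highest_norm_pos by (simp add: z_def nform_def)
  have "z \<in> P"
    using y by (auto simp: P_iff_simple simp flip: nf_cr[OF simple_root])
      (metis imageI inner_commute nf_commute z)
  then show "x \<bullet> y \<in> \<int>" using assms z by metis
qed

text \<open>The coweight lattice, carried over by the normalized form; it is the dual of
  \<open>Q\<close> as \<open>P\<close> is the dual of \<open>M\<close>.\<close>

definition Pv :: "(real ^ 'l) set" where "Pv = {m. \<forall>a\<in>R. nf m a \<in> \<int>}"

lemma nf_Pv_Q: "m \<in> Pv \<Longrightarrow> x \<in> Q \<Longrightarrow> nf m x \<in> \<int>"
  unfolding root_lattice_def
  by (rotate_tac, induction rule: group_closure.induct) (auto simp: nf_simps Pv_def)

lemma in_Q_if_dual: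
  assumes "\<And>y. y \<in> Pv \<Longrightarrow> nf x y \<in> \<int>"
  shows "x \<in> Q"
  unfolding root_lattice_simple
proof (rule in_group_closure_if_dual_Ints[OF indep_B span_B])
  fix y :: "real ^ 'l" assume y: "\<And>c. c \<in> B \<Longrightarrow> y \<bullet> c \<in> \<int>"
  define z where "z = ((\<theta> \<bullet> \<theta>) / 2) *\<^sub>R y"
  have z: "nf u z = u \<bullet> y" for u
    using highest_norm_pos by (simp add: z_def nform_def)
  have "nf z a \<in> \<int>" if "a \<in> R" for a
  proof -
    have "nf z a = (\<Sum>b\<in>B. coef a b * (b \<bullet> y))"
      using z[of a] coef_inner[of a y] by (simp add: nf_commute)
    also have "\<dots> \<in> \<int>"
      using y that by (intro Ints_sum Ints_mult) (auto simp: coef_Ints inner_commute)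
    finally show ?thesis .
  qed
  then have "z \<in> Pv" by (simp add: Pv_def)
  then show "x \<bullet> y \<in> \<int>" using assms z by metis
qed

text \<open>Integral length ratios make the coweights weights; hence shifts by
  \<open>\<kappa> m\<close> with \<open>m\<close> in \<open>Pv\<close> keep \<open>P\<close>
  stable.\<close>

lemma Pv_subset_P: "Pv \<subseteq> P"
  by (auto simp: Pv_def P_iff cartan_ratio ratio_Ints)

text \<open>\<open>\<rho>\<close> pairs to 1 with every simple coroot, so pairing it with
  \<open>cr \<theta> = \<theta>\<close> adds up the coefficients.\<close>

lemma dual_coxeter_eq: "dual_coxeter R B = 1 + nf \<rho> \<theta>"
proof -
  let ?r = "representation (cr ` B) (cr \<theta>)"
  have "cr \<theta> = (\<Sum>b\<in>cr ` B. ?r b *\<^sub>R b)"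
    using sum_representation_eq[OF simple_coroots_basis(1), of "cr \<theta>" "cr ` B"] simple_coroots_basis(2) finite_B by simp
  then have "nf \<rho> (cr \<theta>) = nf \<rho> (\<Sum>b\<in>cr ` B. ?r b *\<^sub>R b)" by simp
  also have "\<dots> = (\<Sum>b\<in>cr ` B. ?r b * nf \<rho> b)"
    by (simp add: nform_def inner_sum_right sum_distrib_left sum_divide_distrib mult.assoc mult.left_commute)
  also have "\<dots> = (\<Sum>b\<in>cr ` B. ?r b)"
    by (intro sum.cong) (auto simp: nf_cr simple_root cartan_rho)
  finally show ?thesis by (simp add: dual_coxeter_def cr_highest)
qed

lemma nf_rho_highest_nonneg: "nf \<rho> \<theta> \<ge> 0" and nf_rho_highest_Ints: "nf \<rho> \<theta> \<in> \<int>"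
proof -
  have "\<rho> \<bullet> b \<ge> 0" if "b \<in> B" for b
    using cartan_ge_0_iff[of b \<rho>] that cartan_rho simple_root by simp
  then show "nf \<rho> \<theta> \<ge> 0"
    using dominant_inner_pos[OF pos_highest] by (simp add: nf_nonneg_iff)
  show "nf \<rho> \<theta> \<in> \<int>"
    using rho_P highest_root(1) by (simp add: nf_highest P_iff)
qed

section \<open>The Weyl group and its action on the lattices\<close>

lemma weyl_linear: "w \<in> W \<Longrightarrow> linear w"
  by (induction rule: weyl_group.induct) (auto simp: linear_id[unfolded id_def] intro: linear_compose[unfolded comp_def] linear_reflection)

lemma weyl_inner: "w \<in> W \<Longrightarrow> w x \<bullet> w y = x \<bullet> y"
  by (induction rule: weyl_group.induct) auto

lemma weyl_nf: "w \<in> W \<Longrightarrow> nf (w x) (w y) = nf x y"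
  by (simp add: nform_def weyl_inner)

lemma weyl_root: "w \<in> W \<Longrightarrow> a \<in> R \<Longrightarrow> w a \<in> R"
  by (induction rule: weyl_group.induct) (auto intro: reflection_in_R)

lemma weyl_comp: "w \<in> W \<Longrightarrow> v \<in> W \<Longrightarrow> w \<circ> v \<in> W"
  by (induction rule: weyl_group.induct) (auto simp: o_assoc[symmetric] id_def[symmetric] intro: weyl_group.intros)

lemma weyl_reflection: "a \<in> R \<Longrightarrow> reflection a \<in> W"
  using weyl_group.refl[OF weyl_group.id, of a] by (simp add: comp_def)

lemma weyl_inverse:
  assumes "w \<in> W"
  obtains v where "v \<in> W" "v \<circ> w = id" "w \<circ> v = id"
proof -
  have "\<exists>v\<in>W. v \<circ> w = id \<and> w \<circ> v = id"
    using assms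
  proof (induction rule: weyl_group.induct)
    case id
    then show ?case using weyl_group.id by (intro bexI[of _ "\<lambda>x. x"]) (auto simp: fun_eq_iff)
  next
    case (refl w a)
    then obtain v where "v \<in> W" "v \<circ> w = id" "w \<circ> v = id" by blast
    then show ?case
      using weyl_comp[of v "reflection a"] weyl_reflection[OF refl(2)]
      by (intro bexI[of _ "v \<circ> reflection a"]) (auto simp: fun_eq_iff)
  qed
  then show ?thesis using that by blast
qed

text \<open>An element is determined by its restriction to the finite spanning set \<open>R\<close>,
  which it maps into itself.\<close>

lemma finite_weyl: "finite W"
proof (rule finite_imageD)
  show "finite ((\<lambda>w. restrict w R) ` W)"
    by (rule finite_subset[OF _ finite_PiE[OF finite_R, of "\<lambda>_. R"]]) (auto simp: finite_R weyl_root)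
  show "inj_on (\<lambda>w. restrict w R) W"
  proof (rule inj_onI)
    fix v w assume vw: "v \<in> W" "w \<in> W" "restrict v R = restrict w R"
    then have "v a = w a" if "a \<in> R" for a using that by (metis restrict_apply')
    then show "v = w"
      using linear_eq_on_span[OF weyl_linear[OF vw(1)] weyl_linear[OF vw(2)], of R] span_R by auto
  qed
qed

lemma weyl_sign_comp:
  assumes "v \<in> W" "w \<in> W"
  shows "weyl_sign (v \<circ> w) = weyl_sign v * weyl_sign w"
  by (simp add: weyl_sign_def matrix_compose weyl_linear assms det_mul)

lemma weyl_sign_id: "weyl_sign (\<lambda>x. x :: real ^ 'l) = 1"
  by (simp add: weyl_sign_def matrix_id_mat_1[unfolded id_def])

lemma weyl_sign_reflection: "a \<in> R \<Longrightarrow> weyl_sign (reflection a) = -1"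
  by (simp add: weyl_sign_def det_reflection root_nonzero)

lemma weyl_sign_square: "w \<in> W \<Longrightarrow> weyl_sign w * weyl_sign w = 1"
proof (induction rule: weyl_group.induct)
  case (refl w a)
  then show ?case using weyl_sign_comp[OF weyl_reflection[OF refl(2)] refl(1)] weyl_sign_reflection[OF refl(2)]
    by (simp add: comp_def)
qed (simp add: weyl_sign_id)

text \<open>Each reflection moves a weight by an integral multiple of a root: the Weyl group acts
  trivially on \<open>P\<close> modulo \<open>Q\<close>.\<close>

lemma weyl_P_diff: "w \<in> W \<Longrightarrow> x \<in> P \<Longrightarrow> w x - x \<in> Q"
proof (induction rule: weyl_group.induct)
  case id
  then show ?case by (simp add: Q_zero)
next
  case (refl w a)
  then have "w x \<in> P" using Q_subset_P P_add[of "w x - x" x] by auto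
  then have "cartan (w x) a \<in> \<int>" using refl by (simp add: P_iff)
  then have "(w x - x) - cartan (w x) a *\<^sub>R a \<in> Q"
    using refl by (intro Q_diff[OF _ Q_scale[OF _ Q_root]])
  then show ?case by (simp add: reflection_cartan algebra_simps)
qed

lemma weyl_P: "w \<in> W \<Longrightarrow> x \<in> P \<Longrightarrow> w x \<in> P"
  using weyl_P_diff[of w x] Q_subset_P P_add[of "w x - x" x] by auto

lemma weyl_cr: "w \<in> W \<Longrightarrow> cr (w a) = w (cr a)"
  by (intro cr_orthogonal weyl_linear weyl_inner)

lemma weyl_M:
  assumes "w \<in> W" "m \<in> M"
  shows "w m \<in> M"
  using assms(2) unfolding coroot_lattice_def
proof (induction rule: group_closure.induct)
  case (base s)
  then show ?case
    using assms(1) weyl_root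
    by (auto simp: linear_0[OF weyl_linear] simp flip: weyl_cr intro!: group_closure.base)
next
  case (diff s t)
  then show ?case using assms(1) by (simp add: linear_diff[OF weyl_linear] group_closure.diff)
qed

text \<open>Dual form of \<open>weyl_P_diff\<close>: moving \<open>w\<close> to the other side of
  the form leaves \<open>m\<close> paired with an element of \<open>Q\<close>.\<close>

lemma weyl_Pv: "w \<in> W \<Longrightarrow> m \<in> Pv \<Longrightarrow> x \<in> P \<Longrightarrow> nf x (w m) - nf x m \<in> \<int>"
proof -
  assume w: "w \<in> W" and m: "m \<in> Pv" and x: "x \<in> P"
  obtain v where v: "v \<in> W" "v \<circ> w = id" "w \<circ> v = id" by (rule weyl_inverse[OF w])
  have "nf x (w m) = nf (v x) (v (w m))" by (simp add: weyl_nf v)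
  also have "v (w m) = m" using v by (metis comp_apply id_apply)
  finally have "nf x (w m) - nf x m = nf m (v x - x)" by (simp add: nf_simps nf_commute)
  then show ?thesis using nf_Pv_Q[OF m weyl_P_diff[OF v(1) x]] by simp
qed

end

section \<open>The affine Weyl group and its fundamental alcove\<close>

lemma cartan_minus_left: "cartan (- x) a = - cartan x a"
  by (simp add: cartan_def)

locale verlinde_data = root_data R B for R B :: "(real ^ 'l) set" +
  fixes k :: nat
begin

definition kap ("\<kappa>") where "\<kappa> = real k + dual_coxeter R B"

lemma kap_Ints: "\<kappa> \<in> \<int>" and rho_less_kap: "nf \<rho> \<theta> < \<kappa>" and kap_pos: "\<kappa> > 0"
  using nf_rho_highest_Ints nf_rho_highest_nonneg by (auto simp: kap_def dual_coxeter_eq)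

definition alcove :: "(real ^ 'l) set" where
  "alcove = {x. (\<forall>b\<in>B. nf x b > 0) \<and> nf x \<theta> < \<kappa>}"

lemma rho_alcove: "\<rho> \<in> alcove"
  using cartan_gt_0_iff[OF simple_root] cartan_rho
  by (auto simp: alcove_def rho_less_kap nf_pos_iff) (metis zero_less_one)

lemma alcove_root:
  assumes "x \<in> alcove" "pos a"
  shows "0 < nf x a" "nf x a < \<kappa>"
proof -
  have x: "x \<bullet> b > 0" if "b \<in> B" for b
    using assms(1) that by (simp add: alcove_def nf_pos_iff)
  have "\<exists>b\<in>B. coef a b \<noteq> 0"
    using coef_eqI[of a 0] assms(2) pos_in_R root_nonzero by (metis coef_zero)
  then obtain b where b: "b \<in> B" "coef a b > 0"
    using coef_nonneg[OF assms(2)] by (metis order_less_le)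
  have "0 < (\<Sum>b\<in>B. coef a b * (b \<bullet> x))"
    using b x by (intro sum_pos2[OF finite_B b(1)])
      (auto simp: inner_commute coef_nonneg assms(2) less_imp_le)
  then show "0 < nf x a" by (simp add: nf_pos_iff coef_inner[of a x] inner_commute[of x])
  have "x \<bullet> (\<theta> - a) \<ge> 0"
    using dominant_inner_nonneg_comb[OF highest_root(2)[OF pos_in_R[OF assms(2)]]] x less_imp_le by blast
  then have "nf x a \<le> nf x \<theta>" using nf_nonneg_iff[of x "\<theta> - a"] by (simp add: nf_simps)
  then show "nf x a < \<kappa>" using assms(1) by (simp add: alcove_def)
qed

text \<open>The pair \<open>(a, c)\<close> encodes the affine root \<open>x \<mapsto> (x, a) + c\<close>.\<close>

definition afun :: "(real ^ 'l) \<times> real \<Rightarrow> real ^ 'l \<Rightarrow> real" where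
  "afun p x = nf x (fst p) + snd p"

definition aref :: "(real ^ 'l) \<times> real \<Rightarrow> real ^ 'l \<Rightarrow> real ^ 'l" where
  "aref p x = x - afun p x *\<^sub>R cr (fst p)"

definition aroots :: "((real ^ 'l) \<times> real) set" where
  "aroots = {(a, of_int n * \<kappa>) | a n. a \<in> R}"

text \<open>The walls of the alcove: it is cut out by positivity of these affine functions. The pair
  \<open>(- \<theta>, \<kappa>)\<close> is the extra node of the affine Dynkin diagram.\<close>

definition asimple :: "((real ^ 'l) \<times> real) set" where
  "asimple = insert (- \<theta>, \<kappa>) ((\<lambda>b. (b, 0)) ` B)"

text \<open>Chosen so that acting on the affine root matches reflecting the argument, as
  \<open>afun_aref\<close> states.\<close>

definition act :: "(real ^ 'l) \<times> real \<Rightarrow> (real ^ 'l) \<times> real \<Rightarrow> (real ^ 'l) \<times> real" where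
  "act q p = (reflection (fst q) (fst p), snd p - snd q * cartan (fst p) (fst q))"

text \<open>For affine roots this is positivity on the alcove; the finite part decides only when the
  constant term is 0.\<close>

definition posaff :: "(real ^ 'l) \<times> real \<Rightarrow> bool" where
  "posaff p \<longleftrightarrow> (if pos (fst p) then snd p \<ge> 0 else snd p > 0)"

lemma arootsI: "a \<in> R \<Longrightarrow> (a, of_int n * \<kappa>) \<in> aroots"
  by (auto simp: aroots_def)

lemma aroots_cases:
  assumes "p \<in> aroots"
  obtains a n where "p = (a, of_int n * \<kappa>)" "a \<in> R"
  using assms by (auto simp: aroots_def)

lemma asimple_aroots: "asimple \<subseteq> aroots"
proof
  fix s assume "s \<in> asimple"
  then consider "s = (- \<theta>, of_int 1 * \<kappa>)" | b where "b \<in> B" "s = (b, of_int 0 * \<kappa>)"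
    by (auto simp: asimple_def)
  then show "s \<in> aroots"
    by cases (simp_all only: arootsI root_uminus highest_root(1) simple_root)
qed

lemma afun_uminus: "afun (- p) x = - afun p x"
  by (simp add: afun_def nf_simps)

text \<open>On the alcove a positive root takes values strictly between 0 and
  \<open>\<kappa>\<close>, while the constant term is a multiple of \<open>\<kappa>\<close> and so
  cannot be outweighed unless it is 0.\<close>

lemma afun_pos_iff:
  assumes "p \<in> aroots" "x \<in> alcove"
  shows "afun p x > 0 \<longleftrightarrow> posaff p" "afun p x < 0 \<longleftrightarrow> \<not> posaff p"
proof -
  obtain a n where p: "p = (a, of_int n * \<kappa>)" "a \<in> R" using assms(1) by (rule aroots_cases)
  define c where "c = of_int n * \<kappa>"
  have c: "c \<ge> 0 \<and> n \<ge> 0 \<or> c \<le> - \<kappa> \<and> n < 0" "c \<ge> \<kappa> \<and> n > 0 \<or> c \<le> 0 \<and> n \<le> 0"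
  proof -
    have "of_int n \<le> (-1::real)" if "n < 0" using that by linarith
    then show "c \<ge> 0 \<and> n \<ge> 0 \<or> c \<le> - \<kappa> \<and> n < 0"
      using kap_pos mult_right_mono[of "of_int n" "-1" \<kappa>] by (cases "n \<ge> 0") (auto simp: c_def)
    have "(1::real) \<le> of_int n" if "n > 0" using that by linarith
    then show "c \<ge> \<kappa> \<and> n > 0 \<or> c \<le> 0 \<and> n \<le> 0"
      using kap_pos mult_right_mono[of 1 "of_int n" \<kappa>]
      by (cases "n > 0") (auto simp: c_def mult_nonpos_nonneg)
  qed
  have p': "p = (a, c)" by (simp add: p c_def)
  have "(afun p x > 0 \<longleftrightarrow> posaff p) \<and> (afun p x < 0 \<longleftrightarrow> \<not> posaff p)"
  proof (cases "pos a")
    case True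
    note x = alcove_root[OF assms(2) True]
    show ?thesis using x True c(1) kap_pos unfolding p' afun_def posaff_def by auto
  next
    case False
    then have "pos (- a)" using pos_cases p by blast
    note x = alcove_root[OF assms(2) this]
    show ?thesis using x False c(2) kap_pos unfolding p' afun_def posaff_def nf_minus_right by auto
  qed
  then show "afun p x > 0 \<longleftrightarrow> posaff p" "afun p x < 0 \<longleftrightarrow> \<not> posaff p" by auto
qed

lemma aroots_uminus: "p \<in> aroots \<Longrightarrow> - p \<in> aroots"
proof (erule aroots_cases)
  fix a n assume p: "p = (a, of_int n * \<kappa>)" "a \<in> R"
  then have "(- a, of_int (- n) * \<kappa>) \<in> aroots" by (intro arootsI root_uminus)
  then show ?thesis using p by simp
qed

lemma posaff_uminus: "p \<in> aroots \<Longrightarrow> posaff (- p) \<longleftrightarrow> \<not> posaff p"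
  using afun_pos_iff[OF _ rho_alcove] aroots_uminus afun_uminus by (metis neg_0_less_iff_less)

lemma act_aroots: "p \<in> aroots \<Longrightarrow> q \<in> aroots \<Longrightarrow> act q p \<in> aroots"
proof (elim aroots_cases)
  fix a n b m assume p: "p = (a, of_int n * \<kappa>)" "a \<in> R" "q = (b, of_int m * \<kappa>)" "b \<in> R"
  obtain c where c: "cartan a b = of_int c" using cartan_Ints[OF p(4,2)] by (rule Ints_cases)
  have "(reflection b a, of_int (n - m * c) * \<kappa>) \<in> aroots" by (intro arootsI reflection_in_R p)
  then show ?thesis by (simp add: act_def p c algebra_simps)
qed

lemma act_uminus: "act q (- p) = - act q p"
  by (simp add: act_def linear_neg[OF linear_reflection] cartan_def)

lemma afun_aref:
  assumes "fst q \<in> R"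
  shows "afun p (aref q x) = afun (act q p) x"
proof -
  have "nf (cr (fst q)) (fst p) = cartan (fst p) (fst q)"
    by (simp add: nf_commute nf_cr assms)
  moreover have "nf x (reflection (fst q) (fst p)) = nf x (fst p) - cartan (fst p) (fst q) * nf x (fst q)"
    by (simp add: reflection_cartan nf_simps)
  ultimately show ?thesis
    by (simp add: afun_def aref_def act_def nf_simps algebra_simps)
qed

text \<open>Conjugating the reflection in \<open>p\<close> by that in \<open>q\<close> gives the
  reflection in \<open>act q p\<close>; in this form it pushes a reflection rightwards through a
  word, in \<open>aref_word\<close>.\<close>

lemma aref_aref:
  assumes "fst q \<in> R"
  shows "aref p (aref q x) = aref q (aref (act q p) x)"
proof -
  let ?a = "fst p" and ?b = "fst q"
  let ?f = "afun (act q p) x"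
  let ?y = "cr (reflection ?b ?a)"
  have "aref q (aref (act q p) x) = x - ?f *\<^sub>R ?y - afun q (x - ?f *\<^sub>R ?y) *\<^sub>R cr ?b"
    by (simp add: aref_def act_def)
  also have "afun q (x - ?f *\<^sub>R ?y) = afun q x - ?f * nf ?y ?b"
    by (simp add: afun_def nf_simps)
  also have "x - ?f *\<^sub>R ?y - (afun q x - ?f * nf ?y ?b) *\<^sub>R cr ?b = aref q x - ?f *\<^sub>R reflection ?b ?y"
    by (simp add: reflection_cr[OF assms] aref_def algebra_simps)
  also have "reflection ?b ?y = cr ?a" by (simp add: cr_reflection)
  also have "aref q x - ?f *\<^sub>R cr ?a = aref p (aref q x)"
    by (simp add: aref_def[of p] afun_aref[OF assms])
  finally show ?thesis ..
qed

lemma aref_involution: "fst q \<in> R \<Longrightarrow> aref q (aref q x) = x"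
proof -
  assume q: "fst q \<in> R"
  have "afun q (aref q x) = - afun q x"
    using nf_cr[OF q, of "fst q"] root_nonzero[OF q]
    by (simp add: afun_def aref_def nf_simps cartan_self nf_commute[of "cr _"])
  then show ?thesis by (simp add: aref_def[of q "aref q x"]) (simp add: aref_def)
qed

lemma posaff_asimple: "s \<in> asimple \<Longrightarrow> posaff s"
  using not_pos_uminus[OF pos_highest] kap_pos by (auto simp: asimple_def posaff_def simple_pos)

lemma act_self: "fst s \<in> R \<Longrightarrow> act s s = - s"
  using root_nonzero[of "fst s"] by (cases s) (auto simp: act_def reflection_self cartan_self)

text \<open>For \<open>(b, 0)\<close> this is \<open>simple_reflection_pos\<close>. For
  \<open>(- \<theta>, \<kappa>)\<close> the reflection turns the constant \<open>n \<kappa>\<close>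
  into \<open>(n + c) \<kappa>\<close>, where \<open>c = cartan a \<theta>\<close> is 0 or 1 up to
  sign by \<open>cartan_highest\<close>, except at \<open>a = \<theta>\<close> and
  \<open>a = - \<theta>\<close>.\<close>

lemma asimple_exchange:
  assumes p: "p \<in> aroots" "posaff p" and s: "s \<in> asimple" and neg: "\<not> posaff (act s p)"
  shows "p = s"
proof -
  obtain a n where a: "p = (a, of_int n * \<kappa>)" "a \<in> R" using p(1) by (rule aroots_cases)
  have nonneg: "real_of_int m * \<kappa> \<ge> 0 \<longleftrightarrow> m \<ge> 0" and positive: "real_of_int m * \<kappa> > 0 \<longleftrightarrow> m > 0" for m
    using kap_pos by (simp_all add: zero_le_mult_iff zero_less_mult_iff)
  have pa: "if pos a then n \<ge> 0 else n > 0"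
    using p(2) by (auto simp: a posaff_def nonneg positive split: if_splits)
  from s consider "s = (- \<theta>, \<kappa>)" | b where "b \<in> B" "s = (b, 0)" by (auto simp: asimple_def)
  then show ?thesis
  proof cases
    case 1
    obtain c where c: "cartan a \<theta> = of_int c" using cartan_Ints[OF highest_root(1) a(2)] by (rule Ints_cases)
    have "act s p = (reflection \<theta> a, of_int (n + c) * \<kappa>)"
      by (simp add: 1 act_def a cartan_minus_right c algebra_simps)
    then have ra: "if pos (reflection \<theta> a) then n + c < 0 else n + c \<le> 0"
      using neg nonneg[of "n + c"] positive[of "n + c"] by (auto simp: posaff_def split: if_splits)
    have ref: "reflection \<theta> a = a - of_int c *\<^sub>R \<theta>" by (simp add: reflection_cartan c)
    have diff: "pos (\<theta> - r) \<or> r = \<theta>" if "r \<in> R" "\<theta> - r \<in> R" for r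
      using highest_root(2)[OF that(1)] that by (auto simp: pos_def)
    show ?thesis
    proof (cases "pos a")
      case True
      then have "n \<ge> 0" using pa by simp
      moreover have "c \<ge> 0"
        using cartan_highest[OF True] c cartan_self[OF root_nonzero[OF highest_root(1)]]
        by (cases "a = \<theta>") auto
      ultimately have "n = 0" "c = 0" using ra by (auto split: if_splits)
      then show ?thesis using ra True ref by simp
    next
      case False
      then have n: "n \<ge> 1" and na: "pos (- a)" using pa pos_cases a by auto
      show ?thesis
      proof (cases "- a = \<theta>")
        case True
        then have a_eq: "a = - \<theta>" by (metis minus_minus)
        then have "cartan a \<theta> = -2"
          using cartan_self[OF root_nonzero[OF highest_root(1)]] by (simp add: cartan_def)
        then have "c = -2" using c by linarith
        moreover have "reflection \<theta> a = \<theta>" using ref a_eq \<open>c = -2\<close> by (simp add: scaleR_2)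
        \<comment> \<open>The bounds \<open>n - 2 < 0\<close> and \<open>n \<ge> 1\<close> single
          out the simple affine root itself.\<close>
        ultimately have "n = 1" using ra n pos_highest by simp
        then show ?thesis by (simp add: 1 a a_eq)
      next
        case False
        then have "cartan (- a) \<theta> = 0 \<or> cartan (- a) \<theta> = 1" using cartan_highest[OF na] by blast
        then have "c = 0 \<or> c = -1" using c by (auto simp: cartan_minus_left)
        then show ?thesis
        proof
          assume "c = 0"
          then show ?thesis using ra n by (auto split: if_splits)
        next
          \<comment> \<open>Here \<open>n + c \<ge> 0\<close> and the reflected root is
            \<open>\<theta> + a\<close>, positive because \<open>\<theta>\<close> is the highest
            root; for a positive finite part even the constant 0 keeps the affine root
            positive.\<close>
          assume c1: "c = -1"
          have "reflection \<theta> a \<in> R" using reflection_in_R highest_root(1) a by blast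
          then have "\<theta> - (- a) \<in> R" using ref c1 by (simp add: add.commute)
          then have "pos (\<theta> - (- a))" using diff[of "- a"] False root_uminus a by auto
          then have "pos (reflection \<theta> a)" using ref c1 by (simp add: add.commute)
          then show ?thesis using ra n c1 by simp
        qed
      qed
    qed
  next
    case 2
    have "act s p = (reflection b a, of_int n * \<kappa>)" by (simp add: 2 act_def a)
    then have ra: "if pos (reflection b a) then n < 0 else n \<le> 0"
      using neg by (auto simp: posaff_def nonneg positive split: if_splits)
    then have "pos a" "n = 0" "\<not> pos (reflection b a)" using pa by (auto split: if_splits)
    then have "a = b" using simple_reflection_pos[OF 2(1)] by blast
    then show ?thesis using 2 a \<open>n = 0\<close> by simp
  qed
qed

section \<open>Words in the simple affine reflections\<close>

fun word :: "((real ^ 'l) \<times> real) list \<Rightarrow> real ^ 'l \<Rightarrow> real ^ 'l" where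
  "word [] x = x"
| "word (s # ss) x = aref s (word ss x)"

text \<open>The letters act on an affine root from left to right, opposite to the order in which
  \<open>word\<close> applies them to a point: this is pullback along the word, as
  \<open>afun_word\<close> records.\<close>

fun pact :: "(real ^ 'l) \<times> real \<Rightarrow> ((real ^ 'l) \<times> real) list \<Rightarrow> (real ^ 'l) \<times> real" where
  "pact p [] = p"
| "pact p (s # ss) = pact (act s p) ss"

lemma asimple_fst: "s \<in> asimple \<Longrightarrow> fst s \<in> R"
  using asimple_aroots by (auto simp: aroots_def)

lemma word_append: "word (ss @ ts) x = word ss (word ts x)"
  by (induction ss) auto

lemma pact_aroots: "p \<in> aroots \<Longrightarrow> set ss \<subseteq> asimple \<Longrightarrow> pact p ss \<in> aroots"
proof (induction ss arbitrary: p)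
  case (Cons s ss)
  then have "s \<in> aroots" "set ss \<subseteq> asimple" using asimple_aroots by auto
  then show ?case using Cons act_aroots by simp
qed simp

lemma pact_uminus: "pact (- p) ss = - pact p ss"
  by (induction ss arbitrary: p) (auto simp: act_uminus)

lemma afun_word: "set ss \<subseteq> asimple \<Longrightarrow> afun p (word ss x) = afun (pact p ss) x"
  by (induction ss arbitrary: p) (simp_all add: afun_aref asimple_fst)

lemma aref_word: "set ss \<subseteq> asimple \<Longrightarrow> aref p (word ss x) = word ss (aref (pact p ss) x)"
proof (induction ss arbitrary: p)
  case (Cons s ss)
  then have s: "fst s \<in> R" and ss: "set ss \<subseteq> asimple" by (simp_all add: asimple_fst)
  show ?case using Cons.IH[OF ss, of "act s p"] aref_aref[OF s, of p "word ss x"] by simp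
qed simp

text \<open>A discrete intermediate value argument: \<open>us\<close> is the prefix read before the
  sign first flips.\<close>

lemma pact_sign_change:
  assumes "\<not> posaff p" "posaff (pact p ss)"
  shows "\<exists>us t vs. ss = us @ t # vs \<and> \<not> posaff (pact p us) \<and> posaff (act t (pact p us))"
  using assms
proof (induction ss arbitrary: p)
  case (Cons s ss)
  show ?case
  proof (cases "posaff (act s p)")
    case True
    then show ?thesis
      using Cons.prems by - (rule exI[of _ "[]"], rule exI[of _ s], rule exI[of _ ss], simp)
  next
    case False
    moreover have "posaff (pact (act s p) ss)" using Cons.prems by simp
    ultimately have "\<exists>us t vs. ss = us @ t # vs \<and> \<not> posaff (pact (act s p) us) \<and>
      posaff (act t (pact (act s p) us))" by (rule Cons.IH)
    then obtain us t vs where "ss = us @ t # vs \<and> \<not> posaff (pact (act s p) us) \<and>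
      posaff (act t (pact (act s p) us))" by (elim exE)
    then show ?thesis by - (rule exI[of _ "s # us"], rule exI[of _ t], rule exI[of _ vs], simp)
  qed
qed simp

text \<open>
  The first letter \<open>s\<close> of a nonempty word is positive after the whole word has acted on it but
  negative after its own action, so some later letter \<open>t\<close> turns it positive again.  By the
  exchange property \<open>s\<close> has then been moved to \<open>t\<close>, and the two letters cancel.
\<close>

lemma word_eq_id:
  assumes "set ss \<subseteq> asimple" "x \<in> alcove" "word ss x \<in> alcove"
  shows "word ss y = y"
  using assms
proof (induction "length ss" arbitrary: ss rule: less_induct)
  case less
  show ?case
  proof (cases ss)
    case (Cons s ts)
    have s: "s \<in> asimple" "s \<in> aroots" and ts: "set ts \<subseteq> asimple"
      using less.prems Cons asimple_aroots by auto
    have "afun s (word ss x) > 0"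
      using afun_pos_iff(1)[OF s(2) less.prems(3)] posaff_asimple[OF s(1)] by simp
    then have "afun (pact s ss) x > 0" using afun_word less.prems by simp
    then have "posaff (pact s ss)"
      using afun_pos_iff(1) pact_aroots less.prems s by blast
    then have "posaff (pact (- s) ts)" using act_self[OF asimple_fst[OF s(1)]] by (simp add: Cons)
    moreover have "\<not> posaff (- s)" using posaff_uminus[OF s(2)] posaff_asimple[OF s(1)] by simp
    ultimately have "\<exists>us t vs. ts = us @ t # vs \<and> \<not> posaff (pact (- s) us) \<and>
        posaff (act t (pact (- s) us))"
      by (intro pact_sign_change)
    then obtain us t vs where split': "ts = us @ t # vs \<and> \<not> posaff (pact (- s) us) \<and>
        posaff (act t (pact (- s) us))"
      by (elim exE)
    note split = split'[THEN conjunct1] split'[THEN conjunct2, THEN conjunct1]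
      split'[THEN conjunct2, THEN conjunct2]
    have us: "set us \<subseteq> asimple" and t: "t \<in> asimple" and vs: "set vs \<subseteq> asimple"
      using ts split by auto
    have q: "pact s us \<in> aroots" using pact_aroots s us by blast
    have "posaff (pact s us)"
      using split(2) posaff_uminus[OF q] by (simp add: pact_uminus)
    moreover have "\<not> posaff (act t (pact s us))"
      using split(3) posaff_uminus[OF act_aroots[OF q, of t]] t asimple_aroots
      by (auto simp: pact_uminus act_uminus)
    ultimately have "pact s us = t" using asimple_exchange q t by blast
    then have "word ss z = word (us @ vs) z" for z
      using aref_word[OF us, of s] aref_involution[OF asimple_fst[OF t]]
      by (simp add: Cons split word_append)
    then show ?thesis
      using less.hyps[of "us @ vs"] less.prems us vs Cons split by simp
  qed simp
qed

section \<open>Weyl elements and translations as words\<close>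

definition in_words :: "(real ^ 'l \<Rightarrow> real ^ 'l) \<Rightarrow> bool" where
  "in_words g \<longleftrightarrow> (\<exists>ss. set ss \<subseteq> asimple \<and> g = word ss)"

lemma in_words_comp: "in_words g \<Longrightarrow> in_words h \<Longrightarrow> in_words (\<lambda>x. g (h x))"
  unfolding in_words_def
proof (elim exE conjE)
  fix ss ts assume "set ss \<subseteq> asimple" "set ts \<subseteq> asimple" "g = word ss" "h = word ts"
  then show "\<exists>us. set us \<subseteq> asimple \<and> (\<lambda>x. g (h x)) = word us"
    by (intro exI[of _ "ss @ ts"]) (auto simp: word_append)
qed

lemma in_words_id: "in_words (\<lambda>x. x)"
  unfolding in_words_def by (intro exI[of _ "[]"]) auto

lemma in_words_simple: "s \<in> asimple \<Longrightarrow> in_words (aref s)"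
  unfolding in_words_def by (intro exI[of _ "[s]"]) auto

lemma in_words_inverse:
  assumes "in_words g" "\<And>x. g (h x) = x"
  shows "in_words h"
proof -
  obtain ss where ss: "set ss \<subseteq> asimple" "g = word ss" using assms by (auto simp: in_words_def)
  have "word (rev ss) (word ss x) = x" for x
    using ss(1) by (induction ss arbitrary: x) (auto simp: word_append aref_involution asimple_fst)
  then have "h = word (rev ss)" using assms(2) ss(2) by (metis ext)
  then show ?thesis using ss(1) by (auto simp: in_words_def intro!: exI[of _ "rev ss"])
qed

lemma aref_simple: "b \<in> B \<Longrightarrow> aref (b, 0) = reflection b"
  by (auto simp: fun_eq_iff aref_def afun_def reflection_cr simple_root)

lemma in_words_simple_reflection: "b \<in> B \<Longrightarrow> in_words (reflection b)"
  using in_words_simple[of "(b, 0)"] by (simp add: asimple_def aref_simple)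

text \<open>Reflections in conjugate roots are conjugate, so \<open>root_induct\<close> reaches all
  of them from the simple ones.\<close>

lemma in_words_reflection: "a \<in> R \<Longrightarrow> in_words (reflection a)"
proof (induction rule: root_induct)
  case (reflect a b)
  have "in_words (reflection b)" by (rule in_words_simple_reflection[OF reflect(2)])
  then have "in_words (\<lambda>x. reflection b (reflection a (reflection b x)))"
    using reflect(3) by (intro in_words_comp[of "reflection b" "\<lambda>x. reflection a (reflection b x)"]
      in_words_comp[of "reflection a" "reflection b"])
  also have "(\<lambda>x. reflection b (reflection a (reflection b x))) = reflection (reflection b a)"
    using reflection_conj[OF linear_reflection inner_reflection, of b a]
    by (intro ext) (metis reflection_reflection)
  finally show ?case .
qed (rule in_words_simple_reflection)

lemma in_words_weyl: "w \<in> W \<Longrightarrow> in_words w"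
proof (induction rule: weyl_group.induct)
  case (refl w a)
  then show ?case using in_words_comp[OF in_words_reflection, of a w] by (simp add: comp_def)
qed (rule in_words_id)

definition translation_vectors :: "(real ^ 'l) set" where
  "translation_vectors = {m. in_words (\<lambda>x. x + \<kappa> *\<^sub>R m)}"

lemma translation_vectors_diff:
  assumes "m \<in> translation_vectors" "n \<in> translation_vectors"
  shows "m - n \<in> translation_vectors"
proof -
  have "in_words (\<lambda>x. x - \<kappa> *\<^sub>R n)"
    by (rule in_words_inverse[of "\<lambda>x. x + \<kappa> *\<^sub>R n"]) (use assms(2) in \<open>auto simp: translation_vectors_def\<close>)
  then have "in_words (\<lambda>x. (x - \<kappa> *\<^sub>R n) + \<kappa> *\<^sub>R m)"
    using assms(1) in_words_comp[of "\<lambda>x. x + \<kappa> *\<^sub>R m" "\<lambda>x. x - \<kappa> *\<^sub>R n"] by (simp add: translation_vectors_def)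
  then show ?thesis by (simp add: translation_vectors_def algebra_simps)
qed

lemma translation_vectors_uminus: "m \<in> translation_vectors \<Longrightarrow> - m \<in> translation_vectors"
  using translation_vectors_diff[OF translation_vectors_diff, of m m m] by simp

lemma translation_vectors_reflection:
  assumes "m \<in> translation_vectors" "a \<in> R"
  shows "reflection a m \<in> translation_vectors"
proof -
  have "in_words (\<lambda>x. reflection a (reflection a x + \<kappa> *\<^sub>R m))"
    using assms(1) in_words_reflection[OF assms(2)]
    by (intro in_words_comp[of "reflection a" "\<lambda>x. reflection a x + \<kappa> *\<^sub>R m"]
        in_words_comp[of "\<lambda>x. x + \<kappa> *\<^sub>R m" "reflection a"]) (auto simp: translation_vectors_def)
  then show ?thesis
    by (simp add: translation_vectors_def linear_add[OF linear_reflection] linear_cmul[OF linear_reflection])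
qed

text \<open>Two parallel mirrors, those of \<open>\<theta>\<close> and of
  \<open>(- \<theta>, \<kappa>)\<close>, compose to a translation; the additional simple affine
  reflection enters here.\<close>

lemma translation_vectors_highest: "\<theta> \<in> translation_vectors"
proof -
  have "in_words (\<lambda>x. aref (- \<theta>, \<kappa>) (reflection \<theta> x))"
    by (intro in_words_comp[of "aref (- \<theta>, \<kappa>)" "reflection \<theta>"] in_words_simple
        in_words_reflection highest_root) (simp add: asimple_def)
  moreover have "aref (- \<theta>, \<kappa>) (reflection \<theta> x) = x + \<kappa> *\<^sub>R \<theta>" for x
  proof -
    have "cr (- \<theta>) = - \<theta>" using cr_highest by (simp add: nu_coroot_def nf_simps)
    then have "aref (- \<theta>, \<kappa>) y = reflection \<theta> y + \<kappa> *\<^sub>R \<theta>" for y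
      using cr_highest by (simp add: aref_def afun_def reflection_cr highest_root nf_simps algebra_simps)
    then show ?thesis by simp
  qed
  ultimately show ?thesis by (simp add: translation_vectors_def)
qed

text \<open>Weyl reflections conjugate translations to translations, so the long roots already
  reached form a reflection-closed set \<open>T\<close> containing \<open>\<theta>\<close>. By
  irreducibility \<open>T\<close> has a member not orthogonal to a given root
  \<open>r\<close>.\<close>

lemma translation_vectors_M: "M \<subseteq> translation_vectors"
proof
  have root: "cr r \<in> translation_vectors" if r: "r \<in> R" for r
  proof -
    define T where "T = {t \<in> R. norm t = norm \<theta> \<and> t \<in> translation_vectors}"
    obtain t where t: "t \<in> T" "t \<bullet> r \<noteq> 0"
    proof (rule reflection_closed_meets[OF _ _ _ r, of T])
      show "T \<noteq> {}" using highest_root translation_vectors_highest by (auto simp: T_def)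
    qed (auto simp: T_def norm_eq_sqrt_inner reflection_in_R translation_vectors_reflection)
    have tR: "t \<in> R" and nt: "norm t = norm \<theta>" and tt: "t \<in> translation_vectors" using t by (auto simp: T_def)
    have rt: "ratio t = 1"
      using nt root_nonzero[OF tR] root_nonzero[OF highest_root(1)] by (simp add: ratio_def norm_eq)
    then have crt: "cr t = t" by (simp add: cr_eq tR)
    show ?thesis
    proof (cases "r = t \<or> r = - t")
      case True
      moreover have "cr (- t) = - t" using crt by (simp add: nu_coroot_def nf_simps)
      ultimately show ?thesis using crt tt translation_vectors_uminus by auto
    next
      case False
      \<comment> \<open>the coroot of \<open>r\<close> is, up to sign, a difference of two long roots\<close>
      have d: "t - reflection r t \<in> translation_vectors"
        using translation_vectors_diff translation_vectors_reflection tt r by blast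
      have "nf t r = cartan r t" using nf_cr[OF tR, of r] by (simp add: crt nf_commute)
      then have "t - reflection r t = cartan r t *\<^sub>R cr r"
        by (simp add: reflection_cr r)
      moreover have "cartan r t = 1 \<or> cartan r t = -1" using cartan_long[OF tR nt r t(2)] False by auto
      ultimately show ?thesis using d translation_vectors_uminus by fastforce
    qed
  qed
  fix m assume "m \<in> M"
  then show "m \<in> translation_vectors" unfolding coroot_lattice_def
  proof (induction rule: group_closure.induct)
    case (base s)
    have "0 \<in> translation_vectors" by (simp add: translation_vectors_def in_words_id)
    then show ?case using base root by auto
  qed (rule translation_vectors_diff)
qed

lemma in_words_affine:
  assumes "w \<in> W" "m \<in> M"
  shows "in_words (\<lambda>x. w x + \<kappa> *\<^sub>R m)"
  using in_words_comp[of "\<lambda>x. x + \<kappa> *\<^sub>R m" w] in_words_weyl[OF assms(1)] assms(2) translation_vectors_M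
  by (auto simp: translation_vectors_def)

text \<open>Freeness of the affine Weyl group on alcove points; \<open>word_eq_id\<close> applies
  since the map is a word.\<close>

lemma affine_eq_id:
  assumes "w \<in> W" "m \<in> M" "x \<in> alcove" "w x + \<kappa> *\<^sub>R m \<in> alcove"
  shows "w y + \<kappa> *\<^sub>R m = y"
  using in_words_affine[OF assms(1,2)] word_eq_id assms(3,4) unfolding in_words_def by metis

lemma nf_M_Q: "m \<in> M \<Longrightarrow> a \<in> R \<Longrightarrow> nf m a \<in> \<int>"
  unfolding coroot_lattice_def
proof (induction rule: group_closure.induct)
  case (base s)
  then show ?case by (auto simp: nf_simps nf_commute[of "cr _"] nf_cr cartan_Ints)
qed (simp add: nf_simps)

section \<open>Regular points and their conjugates in the alcove\<close>

definition regular :: "real ^ 'l \<Rightarrow> bool" where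
  "regular v \<longleftrightarrow> (\<forall>a\<in>R. \<forall>n\<in>\<int>. nf v a \<noteq> n * \<kappa>)"

lemma regular_affine:
  assumes "regular v" "w \<in> W" "m \<in> M"
  shows "regular (w v + \<kappa> *\<^sub>R m)"
  unfolding regular_def
proof (intro ballI notI)
  fix a n assume a: "a \<in> R" "n \<in> \<int>" "nf (w v + \<kappa> *\<^sub>R m) a = n * \<kappa>"
  obtain u where u: "u \<in> W" "u \<circ> w = id" "w \<circ> u = id" by (rule weyl_inverse[OF assms(2)])
  have "nf (w v) a = nf (u (w v)) (u a)" by (simp add: weyl_nf u)
  also have "u (w v) = v" using u by (metis comp_apply id_apply)
  finally have "nf v (u a) = (n - nf m a) * \<kappa>" using a by (simp add: nf_simps algebra_simps)
  moreover have "n - nf m a \<in> \<int>" using nf_M_Q assms a by simp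
  ultimately show False using assms(1) weyl_root[OF u(1) a(1)] by (auto simp: regular_def)
qed

lemma finite_P_cartan: "finite {x \<in> P. \<forall>b\<in>B. \<bar>cartan x b\<bar> \<le> K}"
proof (rule finite_imageD)
  let ?X = "{x \<in> P. \<forall>b\<in>B. \<bar>cartan x b\<bar> \<le> K}"
  let ?N = "\<lceil>K\<rceil>"
  show "finite ((\<lambda>x. restrict (cartan x) B) ` ?X)"
  proof (rule finite_subset)
    show "finite (B \<rightarrow>\<^sub>E (of_int ` {- ?N..?N} :: real set))" by (intro finite_PiE finite_B) auto
    have "cartan x b \<in> of_int ` {- ?N..?N}" if "x \<in> ?X" "b \<in> B" for x b
    proof -
      have "cartan x b \<in> \<int>" using that by (auto simp: P_iff_simple)
      then obtain n where n: "cartan x b = of_int n" by (rule Ints_cases)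
      have "\<bar>of_int n\<bar> \<le> K" using that n by auto
      then have "\<bar>n\<bar> \<le> ?N" by linarith
      then show ?thesis using n by (auto simp: abs_le_iff)
    qed
    then show "(\<lambda>x. restrict (cartan x) B) ` ?X \<subseteq> B \<rightarrow>\<^sub>E (of_int ` {- ?N..?N})" by auto
  qed
  show "inj_on (\<lambda>x. restrict (cartan x) B) ?X"
  proof (rule inj_onI)
    fix x y assume "restrict (cartan x) B = restrict (cartan y) B"
    then have "cartan x b = cartan y b" if "b \<in> B" for b using that by (metis restrict_apply')
    then have "cartan (x - y) b = 0" if "b \<in> B" for b using that by (simp add: cartan_diff)
    then have "b \<bullet> (x - y) = 0" if "b \<in> B" for b
      using cartan_eq_0_iff[OF simple_root, of b "x - y"] that by (simp add: inner_commute)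
    then have "(x - y) \<bullet> (x - y) = 0" by (subst coef_inner) simp
    then show "x = y" by simp
  qed
qed

lemma finite_P_bounded:
  assumes "bounded X"
  shows "finite (P \<inter> X)"
proof -
  obtain r where r: "\<And>x. x \<in> X \<Longrightarrow> norm x \<le> r" "r > 0" using assms by (auto simp: bounded_pos)
  define K where "K = (\<Sum>b\<in>B. 2 * r / norm b)"
  have "\<bar>cartan x b\<bar> \<le> K" if "x \<in> X" "b \<in> B" for x b
  proof -
    have b: "norm b > 0" using simple_root root_nonzero that by simp
    have "\<bar>cartan x b\<bar> = 2 * \<bar>x \<bullet> b\<bar> / (norm b * norm b)"
      by (simp add: cartan_def abs_mult dot_square_norm power2_eq_square)
    also have "\<dots> \<le> 2 * (r * norm b) / (norm b * norm b)"
    proof (intro divide_right_mono mult_left_mono)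
      have "\<bar>x \<bullet> b\<bar> \<le> norm x * norm b" by (rule Cauchy_Schwarz_ineq2)
      also have "\<dots> \<le> r * norm b" using r(1)[OF that(1)] by (intro mult_right_mono) auto
      finally show "\<bar>x \<bullet> b\<bar> \<le> r * norm b" .
    qed auto
    also have "\<dots> = 2 * r / norm b" using b by simp
    also have "\<dots> \<le> K" unfolding K_def
      using that r(2) by (intro member_le_sum finite_B) auto
    finally show ?thesis .
  qed
  then have "P \<inter> X \<subseteq> {x \<in> P. \<forall>b\<in>B. \<bar>cartan x b\<bar> \<le> K}" by auto
  then show ?thesis using finite_subset finite_P_cartan by blast
qed

lemma nf_self_norm: "nf x x = 2 / (\<theta> \<bullet> \<theta>) * (norm x)\<^sup>2"
  by (simp add: nform_def dot_square_norm)

text \<open>Measured by \<open>nf\<close>, the squared distance to \<open>\<rho>\<close> changes by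
  \<open>2 * ratio a * afun s z * afun s \<rho>\<close> with \<open>a = fst s\<close>, which is
  negative when the wall separates \<open>z\<close> from \<open>\<rho>\<close>.\<close>

lemma aref_closer:
  assumes "fst s \<in> R" "afun s z < 0" "afun s \<rho> > 0"
  shows "norm (aref s z - \<rho>) < norm (z - \<rho>)"
proof -
  let ?a = "fst s" and ?f = "afun s z"
  have "nf (cr ?a) (cr ?a) = 2 * ratio ?a"
    using nf_cr[OF assms(1), of "cr ?a"] cartan_self[OF root_nonzero[OF assms(1)]]
    by (simp add: cr_eq assms(1) cartan_scaleR)
  moreover have "nf (z - \<rho>) (cr ?a) = ratio ?a * (?f - afun s \<rho>)"
    by (simp add: cr_eq assms(1) afun_def nf_simps)
  moreover have "nf (y - ?f *\<^sub>R c) (y - ?f *\<^sub>R c) = nf y y - 2 * ?f * nf y c + ?f * ?f * nf c c" for y c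
    by (simp add: nf_simps nf_commute[of c y] algebra_simps)
  moreover have "aref s z - \<rho> = (z - \<rho>) - ?f *\<^sub>R cr ?a" by (simp add: aref_def)
  ultimately have "nf (aref s z - \<rho>) (aref s z - \<rho>) = nf (z - \<rho>) (z - \<rho>) + 2 * ratio ?a * (?f * afun s \<rho>)"
    by (simp only:) (simp add: algebra_simps)
  moreover have "2 * ratio ?a * (?f * afun s \<rho>) < 0"
    using ratio_pos[OF assms(1)] assms by (simp add: mult_pos_neg mult_neg_pos)
  ultimately have "nf (aref s z - \<rho>) (aref s z - \<rho>) < nf (z - \<rho>) (z - \<rho>)" by simp
  then have "(norm (aref s z - \<rho>))\<^sup>2 < (norm (z - \<rho>))\<^sup>2"
    using highest_norm_pos by (simp add: nf_self_norm divide_less_cancel)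
  then show ?thesis by (rule power2_less_imp_less) simp
qed

text \<open>
  The orbit point closest to \<open>\<rho>\<close> lies in the alcove: a wall separating it from \<open>\<rho>\<close> would reflect
  it to a closer one.
\<close>

lemma regular_conjugate:
  assumes "v \<in> P" "regular v"
  obtains w m where "w \<in> W" "m \<in> M" "w v + \<kappa> *\<^sub>R m \<in> alcove"
proof -
  define U where "U = {w v + \<kappa> *\<^sub>R m | w m. w \<in> W \<and> m \<in> M}"
  have UP: "U \<subseteq> P"
    using M_subset_P P_add[OF weyl_P[OF _ assms(1)] P_scale[OF kap_Ints]] by (auto simp: U_def)
  have UI: "w v + \<kappa> *\<^sub>R m \<in> U" if "w \<in> W" "m \<in> M" for w m
    using that by (auto simp: U_def)
  have vU: "v \<in> U" using UI[OF weyl_group.id M_zero] by simp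
  \<comment> \<open>The orbit is infinite, but its points outside this ball are farther from
    \<open>\<rho>\<close> than \<open>v\<close>, and the lattice meets the ball in finitely many
    points.\<close>
  define V where "V = U \<inter> cball \<rho> (norm (v - \<rho>))"
  have "finite V"
    using UP by (intro finite_subset[OF _ finite_P_bounded[OF bounded_cball]]) (auto simp: V_def)
  moreover have "v \<in> V" using vU by (simp add: V_def dist_norm norm_minus_commute)
  ultimately have "Min ((\<lambda>z. norm (z - \<rho>)) ` V) \<in> (\<lambda>z. norm (z - \<rho>)) ` V" by (intro Min_in) auto
  then obtain z where z: "z \<in> V" "norm (z - \<rho>) = Min ((\<lambda>z. norm (z - \<rho>)) ` V)" by auto
  have zmin: "norm (z - \<rho>) \<le> norm (y - \<rho>)" if "y \<in> U" for y
  proof (cases "y \<in> V")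
    case True
    then show ?thesis using z(2) \<open>finite V\<close> by simp
  next
    case False
    then show ?thesis using that z(1) by (auto simp: V_def dist_norm norm_minus_commute)
  qed
  obtain w m where wm: "w \<in> W" "m \<in> M" "z = w v + \<kappa> *\<^sub>R m" using z(1) by (auto simp: V_def U_def)
  have reg: "regular z" using regular_affine assms(2) wm by simp
  have pos: "afun s z > 0" if s: "s \<in> asimple" for s
  proof -
    obtain a n where an: "s = (a, of_int n * \<kappa>)" "a \<in> R" using s asimple_aroots aroots_cases by blast
    \<comment> \<open>The reflected point is put back into the form
      \<open>w' v + \<kappa> m'\<close>, so it competes with \<open>z\<close> in the
      minimum.\<close>
    have "aref s z = reflection a (w v) + \<kappa> *\<^sub>R (reflection a m - of_int n *\<^sub>R cr a)"
      unfolding wm(3)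
      by (simp add: an aref_def afun_def reflection_cr nf_simps algebra_simps)
    moreover have "reflection a m - of_int n *\<^sub>R cr a \<in> M"
      using weyl_M[OF weyl_reflection] an wm by (intro M_diff M_scale M_coroot) auto
    moreover have "(\<lambda>x. reflection a (w x)) \<in> W"
      using weyl_group.refl[OF wm(1) an(2)] by (simp add: comp_def)
    ultimately have "aref s z \<in> U" using UI by simp
    then have "\<not> afun s z < 0"
      using zmin aref_closer[of s z] afun_pos_iff(1)[OF _ rho_alcove, of s] posaff_asimple[OF s]
        asimple_fst[OF s] s asimple_aroots by force
    moreover have "afun s z \<noteq> 0"
    proof
      assume "afun s z = 0"
      then have "nf z a = of_int (- n) * \<kappa>" by (simp add: an afun_def)
      then show False using reg an(2) Ints_of_int unfolding regular_def by blast
    qed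
    ultimately show ?thesis by simp
  qed
  have "z \<in> alcove"
    using pos[of "(- \<theta>, \<kappa>)"] pos[of "(b, 0)" for b]
    by (auto simp: alcove_def asimple_def afun_def nf_simps)
  then show ?thesis using that wm by blast
qed

lemma regular_alcove: "x \<in> alcove \<Longrightarrow> regular x"
  unfolding regular_def
proof (intro ballI notI)
  fix a n assume x: "x \<in> alcove" and a: "a \<in> R" and "n \<in> \<int>" "nf x a = n * \<kappa>"
  then obtain i where "nf x a = of_int i * \<kappa>" by (auto elim: Ints_cases)
  then have "afun (a, of_int (- i) * \<kappa>) x = 0" by (simp add: afun_def)
  then show False using afun_pos_iff[OF arootsI[OF a, of "- i"] x] by force
qed

text \<open>Two off-by-one shifts. Integrality turns \<open>cartan x b \<ge> 0\<close> into
  \<open>cartan (x + \<rho>) b > 0\<close> since \<open>\<rho>\<close> pairs to 1, and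
  \<open>nf x \<theta> \<le> k\<close> into \<open>nf (x + \<rho>) \<theta> < \<kappa>\<close> since
  \<open>\<kappa> = k + 1 + nf \<rho> \<theta>\<close>.\<close>

lemma level_weights_iff: "x \<in> level_weights R B k \<longleftrightarrow> x + \<rho> \<in> P \<and> x + \<rho> \<in> alcove"
proof
  assume x: "x \<in> level_weights R B k"
  then have xP: "x \<in> P" and d: "\<And>b. b \<in> B \<Longrightarrow> cartan x b \<ge> 0" and t: "nf x \<theta> \<le> real k"
    by (auto simp: level_weights_def nf_cr simple_root)
  have "nf (x + \<rho>) b > 0" if "b \<in> B" for b
    using d[OF that] cartan_gt_0_iff[OF simple_root[OF that], of "x + \<rho>"] that
    by (simp add: nf_pos_iff cartan_add cartan_rho)
  moreover have "nf (x + \<rho>) \<theta> < \<kappa>" using t by (simp add: nf_simps kap_def dual_coxeter_eq)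
  ultimately show "x + \<rho> \<in> P \<and> x + \<rho> \<in> alcove" using xP rho_P P_add by (simp add: alcove_def)
next
  assume x: "x + \<rho> \<in> P \<and> x + \<rho> \<in> alcove"
  then have xP: "x \<in> P" using P_diff[of "x + \<rho>" \<rho>] rho_P by simp
  have "nf x (cr b) \<ge> 0" if "b \<in> B" for b
  proof -
    have "cartan (x + \<rho>) b > 0"
      using x that cartan_gt_0_iff[OF simple_root[OF that]] by (simp add: alcove_def nf_pos_iff)
    then have "cartan x b > -1" using that by (simp add: cartan_add cartan_rho)
    moreover have "cartan x b \<in> \<int>" using xP that by (simp add: P_iff_simple)
    ultimately show ?thesis using nf_cr[OF simple_root[OF that]] by (auto elim!: Ints_cases)
  qed
  moreover have "nf x \<theta> \<le> real k"
  proof -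
    have "nf x \<theta> < real k + 1" using x by (simp add: alcove_def nf_simps kap_def dual_coxeter_eq)
    moreover have "nf x \<theta> \<in> \<int>" using xP highest_root(1) by (simp add: nf_highest P_iff)
    then obtain i where i: "nf x \<theta> = of_int i" by (rule Ints_cases)
    ultimately have "i < int k + 1" by linarith
    then have "i \<le> int k" by simp
    then show ?thesis unfolding i by linarith
  qed
  ultimately show "x \<in> level_weights R B k" using xP by (simp add: level_weights_def)
qed

lemma finite_level_weights: "finite (level_weights R B k)"
proof (rule finite_subset[OF _ finite_P_cartan])
  define K where "K = (\<Sum>b\<in>B. \<kappa> * ratio b) + (\<Sum>b\<in>B. \<bar>cartan \<rho> b\<bar>)"
  show "level_weights R B k \<subseteq> {x \<in> P. \<forall>b\<in>B. \<bar>cartan x b\<bar> \<le> K}"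
  proof
    fix x assume x: "x \<in> level_weights R B k"
    have "\<bar>cartan x b\<bar> \<le> K" if b: "b \<in> B" for b
    proof -
      have "0 < nf (x + \<rho>) b" "nf (x + \<rho>) b < \<kappa>"
        using x alcove_root[OF _ simple_pos[OF b]] by (auto simp: level_weights_iff)
      then have "\<bar>cartan (x + \<rho>) b\<bar> \<le> \<kappa> * ratio b"
        using ratio_pos[OF simple_root[OF b]] by (simp add: cartan_ratio simple_root b abs_mult)
      also have "\<dots> \<le> (\<Sum>b\<in>B. \<kappa> * ratio b)"
        using ratio_pos[OF simple_root] kap_pos by (intro member_le_sum finite_B b) (auto simp: less_imp_le)
      finally have 1: "\<bar>cartan (x + \<rho>) b\<bar> \<le> (\<Sum>b\<in>B. \<kappa> * ratio b)" .
      have 2: "\<bar>cartan \<rho> b\<bar> \<le> (\<Sum>b\<in>B. \<bar>cartan \<rho> b\<bar>)"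
        by (intro member_le_sum finite_B b) auto
      have "cartan x b = cartan (x + \<rho>) b - cartan \<rho> b" by (simp add: cartan_add)
      then show ?thesis unfolding K_def using 1 2 by linarith
    qed
    then show "x \<in> {x \<in> P. \<forall>b\<in>B. \<bar>cartan x b\<bar> \<le> K}"
      using x by (simp add: level_weights_def)
  qed
qed

end

section \<open>Unitarity of the S-matrix and selection rule for fusion coefficients\<close>

definition ee :: "real \<Rightarrow> complex" where "ee t = cis (2 * pi * t)"

lemma ee_add: "ee (s + t) = ee s * ee t"
  by (simp add: ee_def cis_mult distrib_left)

lemma ee_zero [simp]: "ee 0 = 1" by (simp add: ee_def)

lemma ee_nonzero [simp]: "ee t \<noteq> 0" by (simp add: ee_def)

lemma cnj_ee: "cnj (ee t) = ee (- t)" by (simp add: ee_def cis_cnj)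

lemma ee_Ints: "t \<in> \<int> \<Longrightarrow> ee t = 1"
  by (auto simp: ee_def elim!: Ints_cases)

lemma ee_eq_1_iff: "ee t = 1 \<longleftrightarrow> t \<in> \<int>"
proof
  assume "ee t = 1"
  then have "cos (2 * pi * t) = 1" by (simp add: ee_def complex_eq_iff)
  then obtain n :: int where "2 * pi * t = of_int n * 2 * pi" using cos_one_2pi_int by blast
  then have "t = of_int n" by simp
  then show "t \<in> \<int>" by simp
qed (rule ee_Ints)

lemma ee_add_Ints: "s - t \<in> \<int> \<Longrightarrow> ee s = ee t"
  using ee_add[of t "s - t"] by (simp add: ee_Ints)

context verlinde_data
begin

abbreviation winv :: "(real ^ 'l \<Rightarrow> real ^ 'l) \<Rightarrow> real ^ 'l \<Rightarrow> real ^ 'l" where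
  "winv \<equiv> inv_into UNIV"

abbreviation I where "I \<equiv> level_weights R B k"

definition F :: "real ^ 'l \<Rightarrow> real ^ 'l \<Rightarrow> complex" where
  "F u v = (\<Sum>w\<in>W. of_real (weyl_sign w) * ee (- nf u (w v) / \<kappa>))"

lemma weyl_inv:
  assumes "w \<in> W"
  shows "winv w \<in> W" "winv w (w x) = x" "w (winv w x) = x" "winv (winv w) = w" "weyl_sign (winv w) = weyl_sign w"
proof -
  obtain v where v: "v \<in> W" "v \<circ> w = id" "w \<circ> v = id" by (rule weyl_inverse[OF assms])
  then have [simp]: "winv w = v" by (metis inv_unique_comp)
  show "winv w \<in> W" "winv w (w x) = x" "w (winv w x) = x" "winv (winv w) = w"
    using v by (auto simp: fun_eq_iff inv_unique_comp)
  have "weyl_sign w * weyl_sign v = 1"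
    using weyl_sign_comp[OF assms v(1)] v(3) weyl_sign_id by (simp add: id_def)
  moreover have "weyl_sign w * weyl_sign w = 1" by (rule weyl_sign_square[OF assms])
  ultimately show "weyl_sign (winv w) = weyl_sign w"
    by (metis \<open>winv w = v\<close> mult.left_commute mult.right_neutral)
qed

text \<open>Substituting the inverse of \<open>w\<close> moves it to the other argument and keeps
  the sign.\<close>

lemma F_sym: "F u v = F v u"
  unfolding F_def
proof (rule sum.reindex_bij_witness[where i = winv and j = winv])
  fix w assume w: "w \<in> W"
  have "nf v (winv w u) = nf (w v) (w (winv w u))" by (simp add: weyl_nf w)
  then have "nf v (winv w u) = nf u (w v)" by (simp add: weyl_inv[OF w] nf_commute)
  then show "complex_of_real (weyl_sign (winv w)) * ee (- nf v (winv w u) / \<kappa>) =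
      complex_of_real (weyl_sign w) * ee (- nf u (w v) / \<kappa>)"
    by (simp add: weyl_inv[OF w])
qed (simp_all add: weyl_inv)

lemma F_weyl:
  assumes "g \<in> W"
  shows "F u (g v) = of_real (weyl_sign g) * F u v"
proof -
  have "F u (g v) = (\<Sum>w\<in>W. of_real (weyl_sign (w \<circ> winv g)) * ee (- nf u (w v) / \<kappa>))"
    unfolding F_def
  proof (rule sum.reindex_bij_witness[where i = "\<lambda>w. w \<circ> winv g" and j = "\<lambda>w. w \<circ> g"])
    fix w assume w: "w \<in> W"
    show "w \<circ> g \<in> W" "w \<circ> winv g \<in> W" using w assms weyl_inv(1) weyl_comp by auto
    show 1: "w \<circ> g \<circ> winv g = w" "w \<circ> winv g \<circ> g = w" using assms by (auto simp: fun_eq_iff weyl_inv)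
    show "complex_of_real (weyl_sign (w \<circ> g \<circ> winv g)) * ee (- nf u ((w \<circ> g) v) / \<kappa>) =
         complex_of_real (weyl_sign w) * ee (- nf u (w (g v)) / \<kappa>)"
      unfolding 1 by simp
  qed
  also have "\<dots> = (\<Sum>w\<in>W. of_real (weyl_sign g) * (of_real (weyl_sign w) * ee (- nf u (w v) / \<kappa>)))"
    using assms by (intro sum.cong) (simp_all add: weyl_sign_comp weyl_inv)
  finally show ?thesis by (simp add: F_def sum_distrib_left)
qed

lemma M_subset_Pv: "M \<subseteq> Pv"
  using nf_M_Q by (auto simp: Pv_def)

text \<open>By \<open>weyl_Pv\<close> the phase \<open>ee (- nf u (w m))\<close> is the same for all
  \<open>w\<close>, so it leaves the alternating sum. For \<open>m\<close> in \<open>M\<close> it is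
  1, which gives \<open>F_periodic\<close>.\<close>

lemma F_shift:
  assumes "u \<in> P" "m \<in> Pv"
  shows "F u (v + \<kappa> *\<^sub>R m) = ee (- nf u m) * F u v"
  unfolding F_def sum_distrib_left
proof (rule sum.cong)
  fix w assume w: "w \<in> W"
  have "- nf u (w (v + \<kappa> *\<^sub>R m)) / \<kappa> = - nf u (w v) / \<kappa> + - nf u (w m)"
    using kap_pos by (simp add: linear_add[OF weyl_linear[OF w]] linear_cmul[OF weyl_linear[OF w]] nf_simps
      add_divide_distrib diff_divide_distrib)
  moreover have "ee (- nf u (w m)) = ee (- nf u m)"
    using Ints_minus[OF weyl_Pv[OF w assms(2,1)]] by (intro ee_add_Ints) simp
  ultimately show "complex_of_real (weyl_sign w) * ee (- nf u (w (v + \<kappa> *\<^sub>R m)) / \<kappa>) =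
      ee (- nf u m) * (complex_of_real (weyl_sign w) * ee (- nf u (w v) / \<kappa>))"
    by (simp only: ee_add mult_ac)
qed simp

lemma F_periodic:
  assumes "u \<in> P" "m \<in> M"
  shows "F u (v + \<kappa> *\<^sub>R m) = F u v"
proof -
  have "ee (- nf u m) = 1" using nf_P_M[OF assms] by (simp add: ee_Ints)
  then show ?thesis using F_shift[of u m v] assms M_subset_Pv by auto
qed

text \<open>A point on a wall is fixed by an affine reflection: periodicity removes the translation
  part, antisymmetry then gives \<open>F u v = - F u v\<close>.\<close>

lemma F_not_regular:
  assumes "u \<in> P" "\<not> regular v"
  shows "F u v = 0"
proof -
  obtain a n where a: "a \<in> R" "n \<in> \<int>" "nf v a = n * \<kappa>" using assms by (auto simp: regular_def)
  have "v = reflection a v + \<kappa> *\<^sub>R (n *\<^sub>R cr a)"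
    using a by (simp add: reflection_cr mult.commute)
  then have "F u v = F u (reflection a v)"
    using F_periodic[OF assms(1) M_scale[OF a(2) M_coroot[OF a(1)]], of "reflection a v"] by simp
  also have "\<dots> = - F u v"
    using F_weyl[OF weyl_reflection[OF a(1)]] weyl_sign_reflection[OF a(1)] by simp
  finally show ?thesis by simp
qed

text \<open>Composing with the inverse of \<open>w'\<close> gives an affine map taking
  \<open>y\<close> to \<open>y'\<close>, the identity by \<open>affine_eq_id\<close>; its value at 0
  shows that the translation part vanishes.\<close>

lemma conjugate_unique:
  assumes "w \<in> W" "w' \<in> W" "m \<in> M" "y \<in> alcove" "y' \<in> alcove" "w' y' = w y + \<kappa> *\<^sub>R m"
  shows "w = w' \<and> y = y'"
proof -
  let ?u = "winv w' \<circ> w" and ?m = "winv w' m"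
  note w' = weyl_inv[OF assms(2)]
  have u: "?u \<in> W" "?m \<in> M" using assms w'(1) weyl_comp weyl_M by auto
  have "y' = winv w' (w y + \<kappa> *\<^sub>R m)" using w'(2)[of y'] assms(6) by simp
  also have "\<dots> = ?u y + \<kappa> *\<^sub>R ?m"
    by (simp add: linear_add[OF weyl_linear[OF w'(1)]] linear_cmul[OF weyl_linear[OF w'(1)]])
  finally have y': "y' = ?u y + \<kappa> *\<^sub>R ?m" .
  then have id: "?u z + \<kappa> *\<^sub>R ?m = z" for z
    using affine_eq_id[OF u assms(4)] assms(5) by simp
  have m0: "\<kappa> *\<^sub>R ?m = 0" using id[of 0] linear_0[OF weyl_linear[OF u(1)]] by simp
  have "w z = w' z" for z
    using id[of z] m0 w'(3)[of "w z"] by simp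
  then show ?thesis using id[of y] y' by auto
qed

section \<open>The finite group \<open>P\<close> modulo \<open>\<kappa> M\<close>: sums and
  characters\<close>

definition KM :: "(real ^ 'l) set" where "KM = (*\<^sub>R) \<kappa> ` M"

lemma KM_I: "m \<in> M \<Longrightarrow> \<kappa> *\<^sub>R m \<in> KM"
  unfolding KM_def by (rule imageI)

lemma KM_zero: "0 \<in> KM"
  using KM_I[OF M_zero] by simp

lemma KM_add: "x \<in> KM \<Longrightarrow> y \<in> KM \<Longrightarrow> x + y \<in> KM"
  by (auto simp: KM_def simp flip: scaleR_add_right intro!: imageI M_add)

lemma KM_minus: "x \<in> KM \<Longrightarrow> - x \<in> KM"
  by (auto simp: KM_def simp flip: scaleR_minus_right intro!: imageI M_minus)

lemma KM_diff: "x \<in> KM \<Longrightarrow> y \<in> KM \<Longrightarrow> x - y \<in> KM"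
  using KM_add[OF _ KM_minus, of x y] by simp

lemma KM_subset_P: "KM \<subseteq> P"
  using M_subset_P P_scale[OF kap_Ints] by (auto simp: KM_def)

text \<open>The choice depends only on the coset of \<open>v\<close> modulo \<open>KM\<close>, so
  \<open>rep\<close> picks one vector per coset and sums over the quotient become sums over a set of
  vectors.\<close>

definition rep :: "real ^ 'l \<Rightarrow> real ^ 'l" where
  "rep v = (SOME y. y - v \<in> KM)"

definition D :: "(real ^ 'l) set" where "D = rep ` P"

lemma rep_diff: "rep v - v \<in> KM"
  unfolding rep_def by (rule someI[of _ v]) (simp add: KM_zero)

lemma rep_eqI:
  assumes "v - w \<in> KM"
  shows "rep v = rep w"
proof -
  have "y - v \<in> KM \<longleftrightarrow> y - w \<in> KM" for y
    using KM_add[OF _ assms, of "y - v"] KM_diff[OF _ assms, of "y - w"] by auto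
  then show ?thesis by (simp add: rep_def)
qed

lemma rep_eqD: "rep v = rep w \<Longrightarrow> v - w \<in> KM"
  using KM_diff[OF rep_diff[of w] rep_diff[of v]] by simp

lemma rep_P: "v \<in> P \<Longrightarrow> rep v \<in> P"
  using P_add[of v "rep v - v"] rep_diff[of v] KM_subset_P by auto

lemma D_subset_P: "D \<subseteq> P" using rep_P by (auto simp: D_def)

lemma rep_rep: "rep (rep v) = rep v"
  by (rule rep_eqI) (rule rep_diff)

lemma rep_D: "v \<in> D \<Longrightarrow> rep v = v"
  by (auto simp: D_def rep_rep)

lemma rep_in_D: "v \<in> P \<Longrightarrow> rep v \<in> D" by (simp add: D_def)

lemma periodic_rep:
  assumes "\<And>v m. v \<in> P \<Longrightarrow> m \<in> M \<Longrightarrow> f (v + \<kappa> *\<^sub>R m) = f v" "v \<in> P"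
  shows "f (rep v) = f v"
proof -
  obtain m where "m \<in> M" "rep v - v = \<kappa> *\<^sub>R m" using rep_diff[of v] by (auto simp: KM_def)
  then have "rep v = v + \<kappa> *\<^sub>R m" by (simp add: algebra_simps)
  then show ?thesis using assms \<open>m \<in> M\<close> by simp
qed

text \<open>Reducing the coordinates in the basis of simple coroots modulo \<open>\<kappa>\<close>
  moves every weight into a fixed ball, and \<open>P\<close> is discrete.\<close>

lemma finite_D: "finite D"
proof -
  let ?C = "cr ` B"
  define K where "K = (\<Sum>c\<in>?C. \<kappa> * norm c)"
  have "\<exists>x\<in>P \<inter> cball 0 K. rep v = rep x" if v: "v \<in> P" for v
  proof -
    define t where "t c = representation ?C v c" for c
    define m where "m = (\<Sum>c\<in>?C. of_int \<lfloor>t c / \<kappa>\<rfloor> *\<^sub>R c)"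
    define x where "x = v - \<kappa> *\<^sub>R m"
    have "m \<in> M" unfolding m_def coroot_lattice_simple
      by (intro group_closure_sum group_closure_scaleR_Ints) (auto intro: group_closure.base)
    then have km: "\<kappa> *\<^sub>R m \<in> KM" by (rule KM_I)
    have "v = (\<Sum>c\<in>?C. t c *\<^sub>R c)"
      using sum_representation_eq[OF simple_coroots_basis(1), of v ?C] simple_coroots_basis(2) finite_B by (simp add: t_def)
    then have "x = (\<Sum>c\<in>?C. (\<kappa> * frac (t c / \<kappa>)) *\<^sub>R c)"
      using kap_pos by (simp add: x_def m_def scaleR_sum_right sum_subtractf[symmetric] frac_def
        right_diff_distrib scaleR_diff_left)
    also have "norm \<dots> \<le> (\<Sum>c\<in>?C. norm ((\<kappa> * frac (t c / \<kappa>)) *\<^sub>R c))" by (rule norm_sum)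
    also have "\<dots> \<le> K" unfolding K_def
    proof (rule sum_mono)
      fix c
      have "\<kappa> * frac (t c / \<kappa>) \<le> \<kappa> * 1"
        using kap_pos frac_lt_1[of "t c / \<kappa>"] by (intro mult_left_mono) auto
      then show "norm ((\<kappa> * frac (t c / \<kappa>)) *\<^sub>R c) \<le> \<kappa> * norm c"
        using kap_pos by (simp add: abs_mult mult_right_mono)
    qed
    finally have "x \<in> P \<inter> cball 0 K" using P_diff v km KM_subset_P by (auto simp: x_def)
    moreover have "rep v = rep x" by (rule rep_eqI) (simp add: x_def km)
    ultimately show ?thesis by blast
  qed
  then have "D \<subseteq> rep ` (P \<inter> cball 0 K)" unfolding D_def by blast
  then show ?thesis using finite_P_bounded[OF bounded_cball] finite_subset by blast
qed

text \<open>Shifting permutes the cosets; \<open>rep\<close> corrects the representatives, and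
  periodicity makes the correction invisible to \<open>f\<close>.\<close>

lemma sum_D_shift:
  fixes f :: "real ^ 'l \<Rightarrow> complex"
  assumes per: "\<And>v m. v \<in> P \<Longrightarrow> m \<in> M \<Longrightarrow> f (v + \<kappa> *\<^sub>R m) = f v" and u: "u \<in> P"
  shows "(\<Sum>v\<in>D. f (v + u)) = (\<Sum>v\<in>D. f v)"
proof (rule sum.reindex_bij_witness[where j = "\<lambda>v. rep (v + u)" and i = "\<lambda>v. rep (v - u)"])
  fix v assume v: "v \<in> D"
  then have vP: "v \<in> P" using D_subset_P by auto
  show "rep (v + u) \<in> D" "rep (v - u) \<in> D" using vP u by (auto intro: rep_in_D P_add P_diff)
  have "rep (rep (v + u) - u) = rep v"
    using rep_diff[of "v + u"] by (intro rep_eqI) (simp add: algebra_simps)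
  then show "rep (rep (v + u) - u) = v" using rep_D[OF v] by simp
  have "rep (rep (v - u) + u) = rep v"
    using rep_diff[of "v - u"] by (intro rep_eqI) (simp add: algebra_simps)
  then show "rep (rep (v - u) + u) = v" using rep_D[OF v] by simp
  show "f (rep (v + u)) = f (v + u)" using periodic_rep[of f] per vP u P_add by blast
qed

text \<open>For \<open>x\<close> outside \<open>KM\<close>, the duality of \<open>M\<close> and
  \<open>P\<close> supplies a shift \<open>y\<close> that multiplies the sum by a phase other than
  1, so the sum vanishes.\<close>

lemma sum_D_character:
  assumes "x \<in> P"
  shows "(\<Sum>v\<in>D. ee (nf x v / \<kappa>)) = (if x \<in> KM then of_nat (card D) else 0)"
proof (cases "x \<in> KM")
  case True
  then obtain m where m: "m \<in> M" "x = \<kappa> *\<^sub>R m" by (auto simp: KM_def)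
  have "ee (nf x v / \<kappa>) = 1" if "v \<in> D" for v
    using nf_P_M[of v m] that D_subset_P m kap_pos
    by (intro ee_Ints) (auto simp: nf_simps nf_commute[of m])
  then show ?thesis using True by simp
next
  case False
  have "(1 / \<kappa>) *\<^sub>R x \<notin> M"
  proof
    assume "(1 / \<kappa>) *\<^sub>R x \<in> M"
    from KM_I[OF this] show False using False kap_pos by simp
  qed
  then obtain y where y: "y \<in> P" "nf ((1 / \<kappa>) *\<^sub>R x) y \<notin> \<int>" using in_M_if_dual by blast
  define f where "f v = ee (nf x v / \<kappa>)" for v
  have "f (v + \<kappa> *\<^sub>R m) = f v" if "m \<in> M" for v m
  proof -
    have "nf x (v + \<kappa> *\<^sub>R m) / \<kappa> - nf x v / \<kappa> = nf x m"
      using kap_pos by (simp add: nf_simps add_divide_distrib)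
    then show ?thesis unfolding f_def using nf_P_M[OF assms that] by (intro ee_add_Ints) simp
  qed
  then have "(\<Sum>v\<in>D. f (v + y)) = (\<Sum>v\<in>D. f v)" using sum_D_shift[of f y] y(1) by blast
  moreover have "f (v + y) = ee (nf x y / \<kappa>) * f v" for v
    by (simp add: f_def nf_simps add_divide_distrib ee_add)
  ultimately have "ee (nf x y / \<kappa>) * (\<Sum>v\<in>D. f v) = (\<Sum>v\<in>D. f v)"
    by (simp add: sum_distrib_left)
  then have "(ee (nf x y / \<kappa>) - 1) * (\<Sum>v\<in>D. f v) = 0"
    by (simp add: left_diff_distrib)
  moreover have "ee (nf x y / \<kappa>) \<noteq> 1" using y(2) by (simp add: ee_eq_1_iff nf_simps)
  ultimately show ?thesis using False by (simp add: f_def)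
qed

text \<open>Sending \<open>(w, y)\<close> to \<open>rep (w y)\<close> is a bijection from pairs of a
  Weyl element and an alcove weight to the regular part of \<open>D\<close>: onto by
  \<open>regular_conjugate\<close>, one-to-one by \<open>conjugate_unique\<close>. The rest of
  \<open>D\<close> contributes nothing by \<open>sing\<close>.\<close>

lemma sum_D_eq_sum_I:
  fixes H :: "real ^ 'l \<Rightarrow> complex"
  assumes per: "\<And>v m. v \<in> P \<Longrightarrow> m \<in> M \<Longrightarrow> H (v + \<kappa> *\<^sub>R m) = H v"
    and inv: "\<And>v w. v \<in> P \<Longrightarrow> w \<in> W \<Longrightarrow> H (w v) = H v"
    and sing: "\<And>v. v \<in> P \<Longrightarrow> \<not> regular v \<Longrightarrow> H v = 0"
  shows "(\<Sum>v\<in>D. H v) = of_nat (card W) * (\<Sum>x\<in>I. H (x + \<rho>))"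
proof -
  let ?Y = "P \<inter> alcove" and ?D = "{v \<in> D. regular v}"
  have "(\<Sum>x\<in>I. H (x + \<rho>)) = (\<Sum>y\<in>?Y. H y)"
    by (rule sum.reindex_bij_witness[where j = "\<lambda>x. x + \<rho>" and i = "\<lambda>y. y - \<rho>"])
       (auto simp: level_weights_iff)
  then have "of_nat (card W) * (\<Sum>x\<in>I. H (x + \<rho>)) = (\<Sum>(w, y)\<in>W \<times> ?Y. H y)"
    by (simp add: sum.cartesian_product[symmetric])
  also have "\<dots> = (\<Sum>v\<in>?D. H v)"
  proof (rule sum.reindex_bij_betw[where h = "\<lambda>(w, y). rep (w y)", THEN trans[rotated]])
    show "bij_betw (\<lambda>(w, y). rep (w y)) (W \<times> ?Y) ?D"
      unfolding bij_betw_def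
    proof
      show "inj_on (\<lambda>(w, y). rep (w y)) (W \<times> ?Y)"
      proof (rule inj_onI; clarify)
        fix w y w' y' assume *: "w \<in> W" "w' \<in> W" "y \<in> alcove" "y' \<in> alcove" "rep (w y) = rep (w' y')"
        have "w' y' - w y \<in> KM" using rep_eqD *(5) by metis
        then obtain m where "m \<in> M" "w' y' - w y = \<kappa> *\<^sub>R m" by (auto simp: KM_def)
        then show "w = w' \<and> y = y'" using conjugate_unique * by (metis add.commute diff_add_cancel)
      qed
      show "(\<lambda>(w, y). rep (w y)) ` (W \<times> ?Y) = ?D"
      proof
        show "(\<lambda>(w, y). rep (w y)) ` (W \<times> ?Y) \<subseteq> ?D"
        proof clarify
          fix w y assume *: "w \<in> W" "y \<in> P" "y \<in> alcove"
          obtain m where m: "m \<in> M" "rep (w y) - w y = \<kappa> *\<^sub>R m" using rep_diff[of "w y"] by (auto simp: KM_def)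
          then have "rep (w y) = w y + \<kappa> *\<^sub>R m" by (simp add: algebra_simps)
          then show "rep (w y) \<in> D \<and> regular (rep (w y))"
            using regular_affine[OF regular_alcove[OF *(3)] *(1) m(1)] rep_in_D[OF weyl_P[OF *(1,2)]] by simp
        qed
        show "?D \<subseteq> (\<lambda>(w, y). rep (w y)) ` (W \<times> ?Y)"
        proof clarify
          fix v assume v: "v \<in> D" "regular v"
          then have vP: "v \<in> P" using D_subset_P by auto
          obtain w m where wm: "w \<in> W" "m \<in> M" "w v + \<kappa> *\<^sub>R m \<in> alcove"
            using regular_conjugate[OF vP v(2)] .
          let ?y = "w v + \<kappa> *\<^sub>R m"
          note w = weyl_inv[OF wm(1)]
          have "\<kappa> *\<^sub>R m \<in> P" using KM_I[OF wm(2)] KM_subset_P by auto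
          then have yP: "?y \<in> P" using P_add weyl_P[OF wm(1) vP] by auto
          have "winv w ?y - v = \<kappa> *\<^sub>R winv w m"
            by (simp add: linear_add[OF weyl_linear[OF w(1)]] linear_cmul[OF weyl_linear[OF w(1)]] w)
          then have "rep (winv w ?y) = rep v"
            using KM_I[OF weyl_M[OF w(1) wm(2)]] by (intro rep_eqI) simp
          then have "v = (\<lambda>(w, y). rep (w y)) (winv w, ?y)" using rep_D[OF v(1)] by simp
          then show "v \<in> (\<lambda>(w, y). rep (w y)) ` (W \<times> ?Y)"
            using w(1) yP wm(3) by (intro image_eqI[of _ _ "(winv w, ?y)"]) auto
        qed
      qed
    qed
    have "H (rep (w y)) = H y" if "w \<in> W" "y \<in> P" for w y
      using periodic_rep[of H, OF per weyl_P[OF that]] inv[OF that(2,1)] by simp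
    then show "(\<Sum>(w, y)\<in>W \<times> ?Y. H y) = (\<Sum>p\<in>W \<times> ?Y. H (case p of (w, y) \<Rightarrow> rep (w y)))"
      by (intro sum.cong) auto
  qed
  also have "\<dots> = (\<Sum>v\<in>D. H v)"
    using sing D_subset_P by (intro sum.mono_neutral_left finite_D) auto
  finally show ?thesis ..
qed

lemma shifted_P: "x \<in> I \<Longrightarrow> x + \<rho> \<in> P" and shifted_alcove: "x \<in> I \<Longrightarrow> x + \<rho> \<in> alcove"
  by (simp_all add: level_weights_iff)

text \<open>After expanding both alternating sums, the inner sum over \<open>D\<close> is a
  character sum, nonzero only when \<open>w' u' - w u\<close> lies in \<open>KM\<close>. Freeness
  reduces this to \<open>w' = w\<close> and \<open>u' = u\<close>, where the signs multiply to
  1.\<close>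

lemma sum_D_F:
  assumes "u \<in> P" "u' \<in> P" "u \<in> alcove" "u' \<in> alcove"
  shows "(\<Sum>v\<in>D. F u v * cnj (F u' v)) = (if u = u' then of_nat (card W * card D) else 0)"
proof -
  have F: "F u v = (\<Sum>w\<in>W. of_real (weyl_sign w) * ee (- nf (w u) v / \<kappa>))" for u v
    using F_sym[of u v] by (simp add: F_def nf_commute)
  have prod_ee: "ee (- nf (w u) v / \<kappa>) * ee (nf (w' u') v / \<kappa>) = ee (nf (w' u' - w u) v / \<kappa>)" for w w' v
    by (simp add: ee_add[symmetric] nf_simps diff_divide_distrib)
  have "(\<Sum>v\<in>D. F u v * cnj (F u' v)) =
      (\<Sum>v\<in>D. \<Sum>w\<in>W. \<Sum>w'\<in>W. of_real (weyl_sign w * weyl_sign w') * ee (nf (w' u' - w u) v / \<kappa>))"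
    unfolding F cnj_sum sum_product
    by (intro sum.cong HOL.refl) (simp add: cnj_ee prod_ee[symmetric] mult_ac)
  also have "\<dots> = (\<Sum>w\<in>W. \<Sum>v\<in>D. \<Sum>w'\<in>W. of_real (weyl_sign w * weyl_sign w') * ee (nf (w' u' - w u) v / \<kappa>))"
    by (rule sum.swap)
  also have "\<dots> = (\<Sum>w\<in>W. \<Sum>w'\<in>W. \<Sum>v\<in>D. of_real (weyl_sign w * weyl_sign w') * ee (nf (w' u' - w u) v / \<kappa>))"
    by (intro sum.cong sum.swap HOL.refl)
  also have "\<dots> = (\<Sum>w\<in>W. \<Sum>w'\<in>W. if w' = w then if u = u' then of_nat (card D) else 0 else 0)"
  proof (intro sum.cong HOL.refl)
    fix w w' assume w: "w \<in> W" "w' \<in> W"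
    have xP: "w' u' - w u \<in> P" using w assms weyl_P P_diff by simp
    have "w' u' - w u \<in> KM \<longleftrightarrow> w' = w \<and> u = u'"
    proof
      assume "w' u' - w u \<in> KM"
      then obtain m where "m \<in> M" "w' u' - w u = \<kappa> *\<^sub>R m" by (auto simp: KM_def)
      then show "w' = w \<and> u = u'"
        using conjugate_unique[OF w(1,2) _ assms(3,4), of m] by (auto simp: algebra_simps)
    qed (simp add: KM_zero)
    then show "(\<Sum>v\<in>D. of_real (weyl_sign w * weyl_sign w') * ee (nf (w' u' - w u) v / \<kappa>)) =
        (if w' = w then if u = u' then of_nat (card D) else 0 else (0 :: complex))"
      using weyl_sign_square[OF w(1)] w
      by (simp add: sum_distrib_left[symmetric] sum_D_character[OF xP] del: of_real_mult)
  qed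
  also have "\<dots> = (if u = u' then of_nat (card W * card D) else 0)"
    by (simp add: sum.delta finite_weyl)
  finally show ?thesis .
qed

lemma card_W_pos: "card W > 0"
  using finite_weyl weyl_group.id by (metis card_gt_0_iff empty_iff)

lemma card_D_pos: "card D > 0"
  using finite_D rep_in_D[OF P_zero] by (metis card_gt_0_iff empty_iff)

lemma weyl_sign_square_complex:
  "w \<in> W \<Longrightarrow> complex_of_real (weyl_sign w) * complex_of_real (weyl_sign w) = 1"
  using weyl_sign_square by (metis of_real_1 of_real_mult)

text \<open>The summand is Weyl invariant because the sign occurs twice, so
  \<open>sum_D_eq_sum_I\<close> folds the sum over \<open>D\<close> onto the weights.\<close>

lemma sum_I_F:
  assumes "x \<in> I" "y \<in> I"
  shows "(\<Sum>z\<in>I. F (x + \<rho>) (z + \<rho>) * cnj (F (y + \<rho>) (z + \<rho>))) = (if x = y then of_nat (card D) else 0)"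
proof -
  note P = shifted_P[OF assms(1)] shifted_P[OF assms(2)]
  have "(\<Sum>v\<in>D. F (x + \<rho>) v * cnj (F (y + \<rho>) v)) =
      of_nat (card W) * (\<Sum>z\<in>I. F (x + \<rho>) (z + \<rho>) * cnj (F (y + \<rho>) (z + \<rho>)))"
  proof (rule sum_D_eq_sum_I)
    fix v w assume w: "w \<in> W"
    show "F (x + \<rho>) (w v) * cnj (F (y + \<rho>) (w v)) = F (x + \<rho>) v * cnj (F (y + \<rho>) v)"
      using weyl_sign_square_complex[OF w] by (simp add: F_weyl[OF w] mult_ac)
  qed (simp_all add: F_periodic P F_not_regular)
  then have "of_nat (card W) * (\<Sum>z\<in>I. F (x + \<rho>) (z + \<rho>) * cnj (F (y + \<rho>) (z + \<rho>))) =
      of_nat (card W) * (if x = y then of_nat (card D) else (0 :: complex))"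
    using sum_D_F[OF P shifted_alcove[OF assms(1)] shifted_alcove[OF assms(2)]] by (auto split: if_splits)
  moreover have "of_nat (card W) \<noteq> (0 :: complex)" using card_W_pos by simp
  ultimately show ?thesis using mult_left_cancel by blast
qed

section \<open>The S-matrix and its inverse\<close>

definition C0 :: complex where
  "C0 = \<i> ^ card (pos_roots R B) * of_real (real (order (add_group P Mod KM)) powr (- 1 / 2))"

lemma S_matrix_eq: "S_matrix R B k x y = C0 * F (x + \<rho>) (y + \<rho>)"
proof -
  have "exp (- (2 * complex_of_real pi * \<i> * complex_of_real t) / complex_of_real \<kappa>) = ee (- t / \<kappa>)" for t
    by (simp add: ee_def cis_conv_exp mult_ac)
  then show ?thesis
    unfolding S_matrix_def Let_def C0_def F_def P_dual KM_def kap_def[symmetric] by simp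
qed

text \<open>An infinite quotient would have \<open>order\<close> 0 and make the power 0; finiteness
  of the set of cosets comes from \<open>finite_D\<close>.\<close>

lemma C0_nonzero: "C0 \<noteq> 0"
proof -
  have "carrier (add_group P Mod KM) = (\<lambda>x. (\<lambda>h. h + x) ` KM) ` P"
    by (auto simp: carrier_FactGroup add_group_def r_coset_def)
  also have "\<dots> = (\<lambda>x. (\<lambda>h. h + x) ` KM) ` D"
  proof -
    have *: "(\<lambda>h. h + x) ` KM = (\<lambda>h. h + rep x) ` KM" for x
    proof
      show "(\<lambda>h. h + x) ` KM \<subseteq> (\<lambda>h. h + rep x) ` KM"
        using KM_diff[OF _ rep_diff[of x]] by (force simp: algebra_simps)
      show "(\<lambda>h. h + rep x) ` KM \<subseteq> (\<lambda>h. h + x) ` KM"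
        using KM_add[OF _ rep_diff[of x]] by (force simp: algebra_simps)
    qed
    show ?thesis unfolding D_def image_image by (intro image_cong[OF HOL.refl *])
  qed
  finally have "finite (carrier (add_group P Mod KM))" "carrier (add_group P Mod KM) \<noteq> {}"
    using finite_D card_D_pos by auto
  then have "order (add_group P Mod KM) \<noteq> 0" by (simp add: order_def)
  then show ?thesis by (simp add: C0_def)
qed

lemma S_matrix_sym: "S_matrix R B k x y = S_matrix R B k y x"
  by (simp add: S_matrix_eq F_sym[of "x + \<rho>"])

text \<open>In fact 1, as \<open>|C0|\<close> is the inverse square root of the number of cosets,
  which \<open>D\<close> represents once each; what follows asks only that it be nonzero.\<close>

definition norm_const :: complex where
  "norm_const = C0 * cnj C0 * of_nat (card D)"

lemma norm_const_nonzero: "norm_const \<noteq> 0"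
  using C0_nonzero card_D_pos by (simp add: norm_const_def)

lemma S_matrix_unitary:
  assumes "x \<in> I" "y \<in> I"
  shows "(\<Sum>z\<in>I. S_matrix R B k x z * cnj (S_matrix R B k y z)) = (if x = y then norm_const else 0)"
proof -
  have "(\<Sum>z\<in>I. S_matrix R B k x z * cnj (S_matrix R B k y z)) =
     C0 * cnj C0 * (\<Sum>z\<in>I. F (x + \<rho>) (z + \<rho>) * cnj (F (y + \<rho>) (z + \<rho>)))"
    by (simp add: S_matrix_eq sum_distrib_left mult_ac)
  then show ?thesis by (simp add: sum_I_F[OF assms] norm_const_def)
qed

text \<open>The S-matrix is symmetric and unitary up to \<open>norm_const\<close>, so its entrywise
  conjugate divided by that constant is a two-sided inverse. The description in
  \<open>matrix_inverse_on\<close> also asks for uniqueness, by the usual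
  \<open>C' = C' S C = C\<close> on \<open>I\<close> and by the prescribed value 0 outside.\<close>

lemma matrix_inverse_S:
  assumes "x \<in> I" "y \<in> I"
  shows "matrix_inverse_on I (S_matrix R B k) x y = cnj (S_matrix R B k x y) / norm_const"
proof -
  let ?S = "S_matrix R B k"
  define C where "C x y = (if x \<in> I \<and> y \<in> I then cnj (?S x y) / norm_const else 0)" for x y
  let ?Q = "\<lambda>C. (\<forall>i j. i \<notin> I \<or> j \<notin> I \<longrightarrow> C i j = 0) \<and>
             (\<forall>i\<in>I. \<forall>j\<in>I. (\<Sum>m\<in>I. ?S i m * C m j) = (if i = j then 1 else 0)) \<and>
             (\<forall>i\<in>I. \<forall>j\<in>I. (\<Sum>m\<in>I. C i m * ?S m j) = (if i = j then 1 else 0))"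
  have SC: "(\<Sum>m\<in>I. ?S i m * C m j) = (if i = j then 1 else 0)" if ij: "i \<in> I" "j \<in> I" for i j
  proof -
    have "(\<Sum>m\<in>I. ?S i m * C m j) = (\<Sum>m\<in>I. ?S i m * cnj (?S j m)) / norm_const"
      unfolding sum_divide_distrib using ij by (intro sum.cong) (auto simp: C_def S_matrix_sym[of j])
    then show ?thesis using S_matrix_unitary[OF ij] norm_const_nonzero by simp
  qed
  have CS: "(\<Sum>m\<in>I. C i m * ?S m j) = (if i = j then 1 else 0)" if ij: "i \<in> I" "j \<in> I" for i j
  proof -
    have "(\<Sum>m\<in>I. C i m * ?S m j) = (\<Sum>m\<in>I. ?S j m * cnj (?S i m)) / norm_const"
      unfolding sum_divide_distrib using ij
      by (intro sum.cong) (auto simp: C_def S_matrix_sym[of _ j] mult.commute)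
    then show ?thesis using S_matrix_unitary[OF ij(2,1)] norm_const_nonzero by simp
  qed
  have "matrix_inverse_on I ?S = C"
    unfolding matrix_inverse_on_def
  proof (rule the_equality)
    show "?Q C" using SC CS by (auto simp: C_def)
    fix C' assume C': "?Q C'"
    have "C' i j = C i j" for i j
    proof (cases "i \<in> I \<and> j \<in> I")
      case True
      have "C' i j = (\<Sum>m\<in>I. C' i m * (\<Sum>n\<in>I. ?S m n * C n j))"
        using True SC by (simp add: finite_level_weights if_distrib[of "\<lambda>t. _ * t"] sum.delta cong: if_cong)
      also have "\<dots> = (\<Sum>n\<in>I. (\<Sum>m\<in>I. C' i m * ?S m n) * C n j)"
        unfolding sum_distrib_left sum_distrib_right by (subst sum.swap) (simp add: mult.assoc)
      also have "\<dots> = (\<Sum>n\<in>I. if n = i then C n j else 0)"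
        using C' True by (intro sum.cong) auto
      also have "\<dots> = C i j" using True by (simp add: finite_level_weights)
      finally show ?thesis .
    next
      case False
      then show ?thesis using C' by (auto simp: C_def)
    qed
    then show "C' = C" by (simp add: fun_eq_iff)
  qed
  then show ?thesis using assms by (simp add: C_def)
qed

lemma fusion_coeff_nonzero:
  assumes "x \<in> I" "y \<in> I" "z \<in> I" "fusion_coeff R B k x y z \<noteq> 0"
  shows "x + y - z \<in> Q"
proof (rule in_Q_if_dual)
  fix m assume m: "m \<in> Pv"
  \<comment> \<open>At a non-regular \<open>v\<close> the denominator vanishes and \<open>G v\<close> is the junk value \<open>0\<close>, as needed.\<close>
  define G where "G v = F (x + \<rho>) v * F (y + \<rho>) v * cnj (F (z + \<rho>) v) / F \<rho> v" for v
  note P = shifted_P[OF assms(1)] shifted_P[OF assms(2)] shifted_P[OF assms(3)]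
  have per: "G (v + \<kappa> *\<^sub>R n) = G v" if "n \<in> M" for v n
    using that by (simp add: G_def F_periodic P rho_P)
  have "fusion_coeff R B k x y z = C0 * cnj C0 / norm_const * (\<Sum>v\<in>I. G (v + \<rho>))"
    unfolding fusion_coeff_def sum_distrib_left
    using C0_nonzero
    by (intro sum.cong) (simp_all add: matrix_inverse_S[OF assms(3)] S_matrix_eq G_def)
  then have "(\<Sum>v\<in>I. G (v + \<rho>)) \<noteq> 0" using assms(4) by auto
  moreover have "(\<Sum>v\<in>D. G v) = of_nat (card W) * (\<Sum>v\<in>I. G (v + \<rho>))"
  proof (rule sum_D_eq_sum_I)
    fix v w assume w: "w \<in> W"
    let ?s = "complex_of_real (weyl_sign w)"
    have s: "?s * ?s = 1" by (rule weyl_sign_square_complex[OF w])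
    then have "?s \<noteq> 0" by auto
    \<comment> \<open>Of the four signs, one from the numerator cancels the one in the denominator;
      the remaining two multiply to 1.\<close>
    then have "G (w v) = (?s * ?s) * G v"
      by (simp add: G_def F_weyl[OF w])
    then show "G (w v) = G v" using s by simp
  qed (simp_all add: per, simp add: G_def F_not_regular rho_P)
  ultimately have ne: "(\<Sum>v\<in>D. G v) \<noteq> 0" using card_W_pos by simp
  \<comment> \<open>As \<open>m\<close> need not lie in \<open>M\<close>, \<open>G\<close> need not
    be periodic under this shift, yet the shift permutes the cosets of \<open>KM\<close> in
    \<open>P\<close> and so preserves the sum.\<close>
  have "\<kappa> *\<^sub>R m \<in> P" using m Pv_subset_P P_scale[OF kap_Ints] by auto
  then have "(\<Sum>v\<in>D. G (v + \<kappa> *\<^sub>R m)) = (\<Sum>v\<in>D. G v)"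
    by (intro sum_D_shift per)
  moreover have "G (v + \<kappa> *\<^sub>R m) = ee (- nf (x + y - z) m) * G v" for v
  proof -
    \<comment> \<open>The four copies of \<open>\<rho>\<close> balance: \<open>(x + \<rho>) + (y +
      \<rho>) - (z + \<rho>) - \<rho> = x + y - z\<close>. Conjugation reverses the sign in the
      factor of \<open>z\<close>.\<close>
    have "ee (- nf (x + y - z) m) * ee (- nf \<rho> m) =
        ee (- nf (x + \<rho>) m) * ee (- nf (y + \<rho>) m) * ee (nf (z + \<rho>) m)"
      by (simp add: ee_add[symmetric] nf_simps algebra_simps)
    then have "ee (- nf (x + \<rho>) m) * ee (- nf (y + \<rho>) m) * ee (nf (z + \<rho>) m) / ee (- nf \<rho> m)
        = ee (- nf (x + y - z) m)"
      by (simp add: field_simps)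
    moreover have "G (v + \<kappa> *\<^sub>R m) =
      (ee (- nf (x + \<rho>) m) * ee (- nf (y + \<rho>) m) * ee (nf (z + \<rho>) m) / ee (- nf \<rho> m)) * G v"
      by (simp only: G_def F_shift[OF P(1) m] F_shift[OF P(2) m] F_shift[OF P(3) m] F_shift[OF rho_P m]
        complex_cnj_mult cnj_ee minus_minus) simp
    ultimately show ?thesis by simp
  qed
  ultimately have "(\<Sum>v\<in>D. G v) = ee (- nf (x + y - z) m) * (\<Sum>v\<in>D. G v)"
    by (simp add: sum_distrib_left)
  then have "ee (- nf (x + y - z) m) = 1" using ne by simp
  then show "nf (x + y - z) m \<in> \<int>" by (simp add: ee_eq_1_iff)
qed

end

section \<open>The grading\<close>

lemma sum_fun_apply: "(\<Sum>i\<in>A. f i) x = (\<Sum>i\<in>A. f i x)" for f :: "'i \<Rightarrow> 'a \<Rightarrow> complex"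
  by (induction A rule: infinite_finite_induct) auto

lemma span_chi:
  fixes X :: "(real ^ 'l) set"
  assumes "finite X"
  shows "cfun.span (chi ` X) = {f. \<forall>x. x \<notin> X \<longrightarrow> f x = 0}"
proof
  have "cfun.subspace {f :: real ^ 'l \<Rightarrow> complex. \<forall>x. x \<notin> X \<longrightarrow> f x = 0}"
    by (rule cfun.subspaceI) (auto simp: cscale_def)
  then show "cfun.span (chi ` X) \<subseteq> {f. \<forall>x. x \<notin> X \<longrightarrow> f x = 0}"
    by (rule cfun.span_minimal[rotated]) (auto simp: chi_def)
  show "{f. \<forall>x. x \<notin> X \<longrightarrow> f x = 0} \<subseteq> cfun.span (chi ` X)"
  proof clarify
    fix f :: "real ^ 'l \<Rightarrow> complex" assume f: "\<forall>x. x \<notin> X \<longrightarrow> f x = 0"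
    have "f = (\<Sum>x\<in>X. cscale (f x) (chi x))"
    proof
      fix y
      have "(\<Sum>x\<in>X. cscale (f x) (chi x)) y = (\<Sum>x\<in>X. if x = y then f x else 0)"
        unfolding sum_fun_apply by (intro sum.cong) (auto simp: cscale_def chi_def)
      then show "f y = (\<Sum>x\<in>X. cscale (f x) (chi x)) y" using f assms by simp
    qed
    moreover have "(\<Sum>x\<in>X. cscale (f x) (chi x)) \<in> cfun.span (chi ` X)"
      by (intro cfun.span_sum cfun.span_scale cfun.span_base) auto
    ultimately show "f \<in> cfun.span (chi ` X)" by metis
  qed
qed

context verlinde_data
begin

lemma comm_group_P: "comm_group (add_group P)"
  by (rule comm_groupI) (auto simp: add_group_def P_add P_zero add_ac intro!: bexI[of _ "- x" for x] P_minus)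

lemma subgroup_Q: "subgroup Q (add_group P)"
proof -
  interpret comm_group "add_group P" by (rule comm_group_P)
  show ?thesis
  proof (rule subgroupI)
    show "Q \<subseteq> carrier (add_group P)" using Q_subset_P by (simp add: add_group_def)
    show "Q \<noteq> {}" using Q_zero by auto
    fix a assume a: "a \<in> Q"
    have "inv\<^bsub>add_group P\<^esub> a = - a"
      using a Q_subset_P by (intro inv_equality) (auto simp: add_group_def P_minus)
    then show "inv\<^bsub>add_group P\<^esub> a \<in> Q" using Q_minus a by simp
  next
    fix a b assume "a \<in> Q" "b \<in> Q"
    then show "a \<otimes>\<^bsub>add_group P\<^esub> b \<in> Q" by (simp add: add_group_def Q_add)
  qed
qed

lemma comm_group_grading: "comm_group (grading_group R B)"
  unfolding grading_group_def using comm_group.abelian_FactGroup[OF comm_group_P subgroup_Q] .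

definition coset :: "real ^ 'l \<Rightarrow> (real ^ 'l) set" where
  "coset x = {y. y - x \<in> Q}"

lemma coset_self: "x \<in> coset x"
  by (simp add: coset_def Q_zero)

lemma coset_eq: "y \<in> coset x \<Longrightarrow> coset y = coset x"
proof -
  assume "y \<in> coset x"
  then have yx: "y - x \<in> Q" by (simp add: coset_def)
  have "z - y \<in> Q \<longleftrightarrow> z - x \<in> Q" for z
    using Q_add[OF _ yx, of "z - y"] Q_diff[OF _ yx, of "z - x"] by auto
  then show ?thesis by (simp add: coset_def)
qed

lemma carrier_grading: "carrier (grading_group R B) = coset ` P"
proof -
  have "Q #>\<^bsub>add_group P\<^esub> x = coset x" for x
  proof
    show "Q #>\<^bsub>add_group P\<^esub> x \<subseteq> coset x" by (auto simp: r_coset_def add_group_def coset_def)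
    show "coset x \<subseteq> Q #>\<^bsub>add_group P\<^esub> x"
    proof
      fix y assume "y \<in> coset x"
      then show "y \<in> Q #>\<^bsub>add_group P\<^esub> x"
        by (auto simp: r_coset_def add_group_def coset_def intro!: bexI[of _ "y - x"])
    qed
  qed
  then show ?thesis
    by (simp add: grading_group_def carrier_FactGroup) (simp add: add_group_def)
qed

lemma grading_mult: "a \<otimes>\<^bsub>grading_group R B\<^esub> b = {x + y | x y. x \<in> a \<and> y \<in> b}"
  by (auto simp: grading_group_def set_mult_def add_group_def)

lemma carrier_grading_eq:
  "a \<in> carrier (grading_group R B) \<Longrightarrow> x \<in> a \<Longrightarrow> a = coset x"
  using coset_eq by (auto simp: carrier_grading)

lemma verlinde_component_eq:
  "verlinde_component R B k a = {f. \<forall>x. \<not> (x \<in> I \<and> x \<in> a) \<longrightarrow> f x = 0}"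
  unfolding verlinde_component_def by (subst span_chi) (auto simp: finite_level_weights)

lemma level_weights_P: "x \<in> I \<Longrightarrow> x \<in> P"
  by (simp add: level_weights_def)

text \<open>Distinct cosets are disjoint, so at the point \<open>x\<close> only the summand indexed
  by the coset of \<open>x\<close> survives; this serves both existence and uniqueness of the
  decomposition.\<close>

lemma sum_components_apply:
  assumes f: "\<And>a. a \<in> carrier (grading_group R B) \<Longrightarrow> f a \<in> verlinde_component R B k a"
    and zero: "\<And>a. a \<notin> carrier (grading_group R B) \<Longrightarrow> f a = 0"
    and fin: "finite {a. f a \<noteq> 0}"
  shows "(\<Sum>a | f a \<noteq> 0. f a) x = f (coset x) x"
proof -
  have "f a x = 0" if "a \<noteq> coset x" for a
  proof (cases "a \<in> carrier (grading_group R B)")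
    case True
    then have "x \<notin> a" using carrier_grading_eq that by blast
    then show ?thesis using f[OF True] by (simp add: verlinde_component_eq)
  qed (simp add: zero)
  then have "(\<Sum>a | f a \<noteq> 0. f a) x = (\<Sum>a | f a \<noteq> 0. if a = coset x then f (coset x) x else 0)"
    unfolding sum_fun_apply by (intro sum.cong) auto
  also have "\<dots> = f (coset x) x" using fin by (auto simp: sum.delta)
  finally show ?thesis .
qed

lemma direct_sum_grading:
  "direct_sum_decomposition (carrier (grading_group R B)) (verlinde_space R B k) (verlinde_component R B k)"
  unfolding direct_sum_decomposition_def
proof (intro conjI ballI)
  fix a assume "a \<in> carrier (grading_group R B)"
  show "cfun.subspace (verlinde_component R B k a)"
    unfolding verlinde_component_def by (rule cfun.subspace_span)
  show "verlinde_component R B k a \<subseteq> verlinde_space R B k"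
    by (auto simp: verlinde_component_eq verlinde_space_def)
next
  fix v assume v: "v \<in> verlinde_space R B k"
  let ?J = "carrier (grading_group R B)"
  let ?P = "\<lambda>f. (\<forall>a\<in>?J. f a \<in> verlinde_component R B k a) \<and> (\<forall>a. a \<notin> ?J \<longrightarrow> f a = 0) \<and>
                finite {a. f a \<noteq> 0} \<and> v = (\<Sum>a | f a \<noteq> 0. f a)"
  define f where "f a = (if a \<in> ?J then (\<lambda>x. if x \<in> a then v x else 0) else 0)" for a
  have v0: "x \<notin> I \<Longrightarrow> v x = 0" for x using v by (simp add: verlinde_space_def)
  have comp: "f a \<in> verlinde_component R B k a" if "a \<in> ?J" for a
    using that v0 by (auto simp: f_def verlinde_component_eq)
  have zero: "f a = 0" if "a \<notin> ?J" for a using that by (simp add: f_def)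
  have "{a. f a \<noteq> 0} \<subseteq> coset ` I"
  proof clarify
    fix a assume "f a \<noteq> 0"
    then obtain x where "a \<in> ?J" "x \<in> a" "v x \<noteq> 0"
      by (auto simp: f_def fun_eq_iff split: if_splits)
    then show "a \<in> coset ` I" using carrier_grading_eq v0 by blast
  qed
  then have fin: "finite {a. f a \<noteq> 0}" using finite_level_weights finite_surj by blast
  have "v x = (\<Sum>a | f a \<noteq> 0. f a) x" for x
  proof -
    have "f (coset x) x = v x"
      using v0[of x] level_weights_P[of x] coset_self[of x]
      by (cases "x \<in> I") (auto simp: f_def carrier_grading)
    then show ?thesis using sum_components_apply[of f x] comp zero fin by simp
  qed
  then have "?P f" using comp zero fin by blast
  moreover have "g = f" if g: "?P g" for g
  proof (intro ext)
    fix a x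
    have vg: "v x = g (coset x) x"
      using sum_components_apply[of g x] g by metis
    have vf: "v x = f (coset x) x"
      using sum_components_apply[of f x] \<open>?P f\<close> by metis
    show "g a x = f a x"
    proof (cases "a \<in> ?J \<and> x \<in> a")
      case True
      then have "a = coset x" using carrier_grading_eq by blast
      then show ?thesis using vg vf by simp
    next
      case False
      show ?thesis
      proof (cases "a \<in> ?J")
        case True
        then have "g a \<in> verlinde_component R B k a" "f a \<in> verlinde_component R B k a"
          using g comp by auto
        then show ?thesis using False True by (simp add: verlinde_component_eq)
      qed (use g zero in auto)
    qed
  qed
  ultimately show "\<exists>!f. ?P f" by blast
qed

lemma grading: "algebra_grading (grading_group R B) (verlinde_space R B k) (verlinde_mult R B k)
    (verlinde_component R B k)"
  unfolding algebra_grading_def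
proof (intro conjI ballI comm_group_grading direct_sum_grading)
  fix a b f g
  assume a: "a \<in> carrier (grading_group R B)" and b: "b \<in> carrier (grading_group R B)"
    and f: "f \<in> verlinde_component R B k a" and g: "g \<in> verlinde_component R B k b"
  have "z \<in> I \<and> z \<in> a \<otimes>\<^bsub>grading_group R B\<^esub> b" if "verlinde_mult R B k f g z \<noteq> 0" for z
  proof -
    have z: "z \<in> I" "(\<Sum>x\<in>I. \<Sum>y\<in>I. f x * g y * fusion_coeff R B k x y z) \<noteq> 0"
      using that by (auto simp: verlinde_mult_def split: if_splits)
    then obtain x y where xy: "x \<in> I" "y \<in> I" "f x * g y * fusion_coeff R B k x y z \<noteq> 0"
      by (meson sum.not_neutral_contains_not_neutral)
    then have q: "x + y - z \<in> Q" using fusion_coeff_nonzero z by auto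
    have xa: "x \<in> a" and yb: "y \<in> b"
      using xy f g by (auto simp: verlinde_component_eq)
    \<comment> \<open>To exhibit \<open>z\<close> as a sum from \<open>a\<close> and
      \<open>b\<close>, the whole defect \<open>x + y - z\<close> in \<open>Q\<close> is taken off
      \<open>x\<close>, which stays in its coset.\<close>
    have "x - (x + y - z) \<in> coset x" using Q_minus[OF q] by (simp add: coset_def algebra_simps)
    then have "x - (x + y - z) \<in> a" using carrier_grading_eq[OF a xa] by simp
    moreover have "z = (x - (x + y - z)) + y" by simp
    ultimately show ?thesis using z yb unfolding grading_mult by blast
  qed
  then show "verlinde_mult R B k f g \<in> verlinde_component R B k (a \<otimes>\<^bsub>grading_group R B\<^esub> b)"
    unfolding verlinde_component_eq by blast
qed

end

theorem theorem1p4: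
  fixes R B :: "(real ^ 'l) set" and k :: nat
  assumes "irreducible_root_system R" and "simple_roots R B" and "k \<ge> 1"
  shows "algebra_grading (grading_group R B) (verlinde_space R B k) (verlinde_mult R B k)
           (verlinde_component R B k)"
proof -
  interpret verlinde_data R B k by unfold_locales (fact assms)+
  show ?thesis by (rule grading)
qed

end
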